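(* Let $G$ be a compactly generated totally disconnected locally compact group that is topologically characteristically simple. Suppose that $G$ is neither discrete nor compact. Then the following hold. (i) No element of $G \smallsetminus \{1\}$ has open centraliser in $G$. (ii) The only virtually soluble locally normal subgroup of $G$ is the identity subgroup $\{1\}$.
   Context: Topological groups are Hausdorff. A locally compact group is compactly generated if it admits a compact generating set. A topological group is topologically characteristically simple if it is non-trivial and its only closed subgroups invariant under all topological group automorphisms are the identity subgroup and the whole group. A subgroup of a topological group $G$ (not necessarily closed) is locally normal in $G$ if its normaliser in $G$ is open. A group is virtually soluble if it has a soluble subgroup of finite index. *)

theory Defs
  imports
    "HOL-Analysis.Analysis"
    "HOL-Algebra.Group_Action"
    "HOL-Algebra.Solvable_Groups"
begin

locale topological_group = group G for G (structure) +
  fixes T :: "'a topology"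
  assumes topspace_eq: "topspace T = carrier G"
    and continuous_mult: "continuous_map (prod_topology T T) T (\<lambda>(x, y). x \<otimes> y)"
    and continuous_inv: "continuous_map T T (\<lambda>x. inv\<^bsub>G\<^esub> x)"
    and Hausdorff: "Hausdorff_space T"

definition totally_disconnected_space :: "'a topology \<Rightarrow> bool" where
  "totally_disconnected_space X \<longleftrightarrow>
     (\<forall>x \<in> topspace X. connected_component_of_set X x = {x})"

definition compactly_generated :: "('a, 'b) monoid_scheme \<Rightarrow> 'a topology \<Rightarrow> bool" where
  "compactly_generated G T \<longleftrightarrow> (\<exists>K. compactin T K \<and> generate G K = carrier G)"

definition top_aut :: "('a, 'b) monoid_scheme \<Rightarrow> 'a topology \<Rightarrow> ('a \<Rightarrow> 'a) set" where
  "top_aut G T = {f \<in> iso G G. homeomorphic_map T T f}"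

definition top_char_simple :: "('a, 'b) monoid_scheme \<Rightarrow> 'a topology \<Rightarrow> bool" where
  "top_char_simple G T \<longleftrightarrow>
     carrier G \<noteq> {\<one>\<^bsub>G\<^esub>} \<and>
     (\<forall>H. subgroup H G \<and> closedin T H \<and> (\<forall>f \<in> top_aut G T. f ` H = H) \<longrightarrow>
        H = {\<one>\<^bsub>G\<^esub>} \<or> H = carrier G)"

definition centralizer :: "('a, 'b) monoid_scheme \<Rightarrow> 'a \<Rightarrow> 'a set" where
  "centralizer G x = {g \<in> carrier G. g \<otimes>\<^bsub>G\<^esub> x = x \<otimes>\<^bsub>G\<^esub> g}"

definition locally_normal :: "'a set \<Rightarrow> ('a, 'b) monoid_scheme \<Rightarrow> 'a topology \<Rightarrow> bool" where
  "locally_normal H G T \<longleftrightarrow> subgroup H G \<and> openin T (normalizer G H)"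

definition virtually_solvable :: "('a, 'b) monoid_scheme \<Rightarrow> bool" where
  "virtually_solvable G \<longleftrightarrow>
     (\<exists>K. subgroup K G \<and> finite (rcosets\<^bsub>G\<^esub> K) \<and> solvable (G\<lparr>carrier := K\<rparr>))"

end

(* A non-trivial subgroup invariant under all automorphisms is dense, so together with a compact open
   subgroup U finitely many of its elements generate G. Three applications: G has no non-trivial
   relatively compact normal subgroup (otherwise G = U N with N relatively compact); elements with
   open centraliser are trivial (finitely many of them centralise an open normal subgroup of U);
   and a non-trivial abelian A, normalised by an open subgroup, yields finitely many automorphisms f
   such that U and the conjugates of the f(A \<inter> W) generate G for every open subgroup W.
   Choose a finite U-invariant family of images of A that generates G together with U, and let M(W)
   be generated by the intersections of its members with W. For small W this is nilpotent by Fitting,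
   and its germ is G-invariant, since [a, c] lies in B when a is in B and c normalises B. The elements
   that centralise the last non-trivial lower central term of some M(W) form a normal set containing
   f(A \<inter> W) for some W. Finitely many of them generate G with U, so such a term is normal in G and
   relatively compact, a contradiction. *)

theory Submission
  imports Defs "HOL-Algebra.Zassenhaus"
begin

section \<open>Conjugation and generated subgroups\<close>

text \<open>The obstacle is the order of the choices. The open subgroup on which commutators vanish
  is known only after the finite family of images of \<open>A\<close> has been fixed, so the
  automorphisms in the family must go on generating \<open>G\<close> when \<open>A\<close> is cut
  down to an arbitrary \<open>A \<inter> W\<close>. Compactness breaks the circle: the closed normal
  subgroups generated by the sets \<open>A \<inter> W\<close> share an element \<open>x\<close>
  other than the identity, and it is the orbit of \<open>x\<close>, which does not depend on
  \<open>W\<close>, that fixes the automorphisms. A second obstacle is that \<open>M W\<close> need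
  not be normal in \<open>G\<close>: conjugation by a generator only carries some smaller
  \<open>M W'\<close> into \<open>M W\<close>, and \<open>W'\<close> depends on the generator.
  Centralising a term \<open>E k W\<close> for some \<open>W\<close> is, however, a condition stable
  under shrinking \<open>W\<close>; it defines a set that is truly invariant under conjugation, and
  finitely many elements of that set have a common \<open>W\<close>. Part (i) is reused in (ii): a
  locally normal subgroup that meets some open subgroup trivially consists of elements with open
  centraliser, so a nontrivial one has nontrivial trace on every open subgroup.\<close>

context group
begin

definition conjugate :: "'a \<Rightarrow> 'a \<Rightarrow> 'a" where
  "conjugate g x = g \<otimes> x \<otimes> inv g"

definition commutator :: "'a \<Rightarrow> 'a \<Rightarrow> 'a" where
  "commutator x y = x \<otimes> y \<otimes> inv x \<otimes> inv y"

text \<open>Only an inclusion is required, so for a set \<open>S\<close> not closed under inverses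
  this says less than lying in the normaliser of \<open>N\<close>. This is why
  \<open>generate_normalizes\<close> asks for the inverses of the generators separately.\<close>

definition normalizes :: "'a set \<Rightarrow> 'a set \<Rightarrow> bool" where
  "normalizes S N \<longleftrightarrow> (\<forall>s\<in>S. \<forall>n\<in>N. conjugate s n \<in> N)"

lemma normalizesD: "\<lbrakk>normalizes S N; s \<in> S; n \<in> N\<rbrakk> \<Longrightarrow> conjugate s n \<in> N"
  by (simp add: normalizes_def)

lemma normalizes_Int: "\<lbrakk>normalizes S M; normalizes S N\<rbrakk> \<Longrightarrow> normalizes S (M \<inter> N)"
  by (auto simp: normalizes_def)

lemma normalizes_mono: "\<lbrakk>normalizes S N; S' \<subseteq> S\<rbrakk> \<Longrightarrow> normalizes S' N"
  by (auto simp: normalizes_def)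

lemma conjugate_closed [simp]: "\<lbrakk>g \<in> carrier G; x \<in> carrier G\<rbrakk> \<Longrightarrow> conjugate g x \<in> carrier G"
  by (simp add: conjugate_def)

lemma commutator_closed [simp]:
  "\<lbrakk>g \<in> carrier G; x \<in> carrier G\<rbrakk> \<Longrightarrow> commutator g x \<in> carrier G"
  by (simp add: commutator_def)

lemma conjugate_mult:
  "\<lbrakk>g \<in> carrier G; x \<in> carrier G; y \<in> carrier G\<rbrakk>
    \<Longrightarrow> conjugate g (x \<otimes> y) = conjugate g x \<otimes> conjugate g y"
  by (simp add: conjugate_def m_assoc inv_solve_left)

lemma conjugate_one_right [simp]: "g \<in> carrier G \<Longrightarrow> conjugate g \<one> = \<one>"
  by (simp add: conjugate_def)

lemma conjugate_one_left [simp]: "x \<in> carrier G \<Longrightarrow> conjugate \<one> x = x"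
  by (simp add: conjugate_def)

lemma conjugate_inv:
  "\<lbrakk>g \<in> carrier G; x \<in> carrier G\<rbrakk> \<Longrightarrow> conjugate g (inv x) = inv (conjugate g x)"
  by (simp add: conjugate_def inv_mult_group m_assoc)

lemma conjugate_conjugate:
  "\<lbrakk>g \<in> carrier G; h \<in> carrier G; x \<in> carrier G\<rbrakk>
    \<Longrightarrow> conjugate g (conjugate h x) = conjugate (g \<otimes> h) x"
  by (simp add: conjugate_def inv_mult_group m_assoc)

lemma conjugate_inv_cancel [simp]:
  assumes "g \<in> carrier G" "x \<in> carrier G"
  shows "conjugate (inv g) (conjugate g x) = x" "conjugate g (conjugate (inv g) x) = x"
  using assms by (simp_all add: conjugate_conjugate)

lemma conjugate_hom: "g \<in> carrier G \<Longrightarrow> conjugate g \<in> hom G G"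
  by (simp add: hom_def conjugate_mult)

lemma conjugate_iso:
  assumes "g \<in> carrier G"
  shows "conjugate g \<in> iso G G"
proof -
  have "bij_betw (conjugate g) (carrier G) (carrier G)"
    by (rule bij_betwI[where g = "conjugate (inv g)"]) (use assms in auto)
  then show ?thesis
    using conjugate_hom[OF assms] by (simp add: iso_def)
qed

lemma conjugate_eq_iff_commute:
  assumes "g \<in> carrier G" "x \<in> carrier G"
  shows "conjugate g x = x \<longleftrightarrow> g \<otimes> x = x \<otimes> g"
  unfolding conjugate_def using assms by (metis inv_solve_right m_closed)

lemma commutator_eq_one_iff:
  assumes "x \<in> carrier G" "y \<in> carrier G"
  shows "commutator x y = \<one> \<longleftrightarrow> x \<otimes> y = y \<otimes> x"
  unfolding commutator_def using assms
  by (metis conjugate_def conjugate_eq_iff_commute conjugate_closed inv_closed inv_comm inv_equality r_inv)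

lemma commutator_conjugate_left: "commutator x y = conjugate x y \<otimes> inv y"
  by (simp add: commutator_def conjugate_def)

lemma commutator_conjugate_right:
  assumes "x \<in> carrier G" "y \<in> carrier G"
  shows "commutator x y = x \<otimes> conjugate y (inv x)"
  using assms by (simp add: commutator_def conjugate_def m_assoc)

lemma hom_generate_subset:
  assumes f: "f \<in> hom G G" and "S \<subseteq> carrier G" and "subgroup H G" and "f ` S \<subseteq> H"
  shows "f ` generate G S \<subseteq> H"
proof -
  interpret group_hom G G f
    using f is_group by (simp add: group_hom_def group_hom_axioms_def)
  show ?thesis
    using assms generate_img generate_subgroup_incl by metis
qed

lemma normalizes_generateI:
  assumes "S \<subseteq> carrier G" and "X \<subseteq> carrier G" and "normalizes X S"
  shows "normalizes X (generate G S)"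
  unfolding normalizes_def
proof (intro ballI)
  fix x n assume "x \<in> X" "n \<in> generate G S"
  moreover have "conjugate x ` S \<subseteq> generate G S"
    using assms(3) \<open>x \<in> X\<close> generate.incl unfolding normalizes_def by fastforce
  ultimately show "conjugate x n \<in> generate G S"
    using hom_generate_subset[OF conjugate_hom _ generate_is_subgroup] assms by blast
qed

lemma generate_normalizes:
  assumes "S \<subseteq> carrier G" and "N \<subseteq> carrier G" and "normalizes S N"
    and "normalizes (m_inv G ` S) N"
  shows "normalizes (generate G S) N"
  unfolding normalizes_def
proof
  fix g assume g: "g \<in> generate G S"
  then show "\<forall>n\<in>N. conjugate g n \<in> N"
  proof (induction rule: generate.induct)
    case one
    then show ?case using assms(2) by auto
  next
    case (incl h)
    then show ?case using assms(3) by (simp add: normalizes_def)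
  next
    case (inv h)
    then show ?case using assms(4) by (simp add: normalizes_def)
  next
    case (eng h1 h2)
    then have "h1 \<in> carrier G" "h2 \<in> carrier G"
      using generate_in_carrier[OF assms(1)] by auto
    then have "conjugate (h1 \<otimes> h2) n = conjugate h1 (conjugate h2 n)" if "n \<in> N" for n
      using that assms(2) by (auto simp: conjugate_conjugate)
    with eng.IH show ?case by simp
  qed
qed

lemma subgroup_normalizes:
  assumes "subgroup H G"
  shows "normalizes H H"
  using assms by (auto simp: normalizes_def conjugate_def subgroup.m_closed subgroup.m_inv_closed)

lemma normal_iff_normalizes:
  "N \<lhd> G \<longleftrightarrow> subgroup N G \<and> normalizes (carrier G) N"
  by (simp add: normal_inv_iff normalizes_def conjugate_def)

lemma normalizes_commuting:
  assumes "X \<subseteq> carrier G" "N \<subseteq> carrier G" "\<And>x n. \<lbrakk>x \<in> X; n \<in> N\<rbrakk> \<Longrightarrow> x \<otimes> n = n \<otimes> x"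
  shows "normalizes X N"
  unfolding normalizes_def
  using assms conjugate_eq_iff_commute by (metis subsetD)

lemma commute_inv:
  assumes "x \<in> carrier G" "n \<in> carrier G" "x \<otimes> n = n \<otimes> x"
  shows "inv x \<otimes> n = n \<otimes> inv x"
  using assms by (metis inv_closed inv_solve_left inv_solve_right m_assoc m_closed)

lemma commutator_swap:
  assumes "subgroup J G" "x \<in> carrier G" "y \<in> carrier G" "commutator x y \<in> J"
  shows "commutator y x \<in> J"
proof -
  have "commutator y x = inv (commutator x y)"
    using assms by (simp add: commutator_def inv_mult_group m_assoc)
  then show ?thesis using assms subgroup.m_inv_closed by metis
qed

end

section \<open>Topological groups\<close>

context topological_group
begin

lemma openin_subset_carrier: "openin T W \<Longrightarrow> W \<subseteq> carrier G"
  using openin_subset topspace_eq by blast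

lemma openin_carrier [simp]: "openin T (carrier G)"
  using topspace_eq openin_topspace by metis

lemma continuous_map_mult:
  assumes "continuous_map X T f" "continuous_map X T g"
  shows "continuous_map X T (\<lambda>x. f x \<otimes> g x)"
proof -
  have "continuous_map X (prod_topology T T) (\<lambda>x. (f x, g x))"
    using assms by (simp add: continuous_map_pairedI)
  from continuous_map_compose[OF this continuous_mult] show ?thesis
    by (simp add: o_def)
qed

lemma continuous_map_minv:
  assumes "continuous_map X T f"
  shows "continuous_map X T (\<lambda>x. inv (f x))"
  using continuous_map_compose[OF assms continuous_inv] by (simp add: o_def)

lemma continuous_map_constant: "c \<in> carrier G \<Longrightarrow> continuous_map X T (\<lambda>x. c)"
  by (simp add: topspace_eq)

lemma continuous_map_ident: "continuous_map T T (\<lambda>x. x)"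
  using continuous_map_id by (simp add: id_def)

lemmas group_continuous_intros = continuous_map_mult continuous_map_minv continuous_map_constant
  continuous_map_ident

lemma continuous_map_conjugate: "g \<in> carrier G \<Longrightarrow> continuous_map T T (conjugate g)"
  unfolding conjugate_def[abs_def] by (intro group_continuous_intros) auto

lemma continuous_map_commutator_left:
  "g \<in> carrier G \<Longrightarrow> continuous_map T T (commutator g)"
  unfolding commutator_def[abs_def] by (intro group_continuous_intros) auto

lemma continuous_map_commutator_right:
  "g \<in> carrier G \<Longrightarrow> continuous_map T T (\<lambda>x. commutator x g)"
  unfolding commutator_def[abs_def] by (intro group_continuous_intros) auto

lemma openin_preimage:
  assumes "continuous_map T T f" "openin T W"
  shows "openin T {x \<in> carrier G. f x \<in> W}"
  using openin_continuous_map_preimage[OF assms] topspace_eq by metis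

text \<open>\<open>H\<close> contains the translate \<open>h W\<close> for each of its points
  \<open>h\<close>. The translate is written as the preimage of \<open>W\<close> under left
  multiplication by \<open>inv h\<close>, because continuity yields open preimages; cosets take a
  similar form in later proofs.\<close>

lemma open_subgroupI:
  assumes "subgroup H G" "openin T W" "\<one> \<in> W" "W \<subseteq> H"
  shows "openin T H"
proof (subst openin_subopen, intro ballI)
  fix h assume h: "h \<in> H"
  have hG: "h \<in> carrier G" and HG: "H \<subseteq> carrier G"
    using h assms(1) subgroup.subset by auto
  define O' where "O' = {x \<in> carrier G. inv h \<otimes> x \<in> W}"
  have "openin T O'"
    unfolding O'_def by (intro openin_preimage group_continuous_intros assms) (use hG in auto)
  moreover have "h \<in> O'"
    using hG assms(3) by (simp add: O'_def)
  moreover have "O' \<subseteq> H"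
  proof
    fix x assume "x \<in> O'"
    then have "x \<in> carrier G" "inv h \<otimes> x \<in> H" using assms(4) by (auto simp: O'_def)
    then have "h \<otimes> (inv h \<otimes> x) \<in> H"
      using assms(1) h by (simp add: subgroup.m_closed)
    then show "x \<in> H"
      using hG \<open>x \<in> carrier G\<close> by (simp add: m_assoc[symmetric])
  qed
  ultimately show "\<exists>O'. openin T O' \<and> h \<in> O' \<and> O' \<subseteq> H" by blast
qed

text \<open>The complement is a union of cosets \<open>x H\<close>, each of them open.\<close>

lemma closedin_open_subgroup:
  assumes "subgroup H G" "openin T H"
  shows "closedin T H"
proof -
  have HG: "H \<subseteq> carrier G" using assms(1) subgroup.subset by auto
  have "openin T (carrier G - H)"
  proof (subst openin_subopen, intro ballI)
    fix x assume x: "x \<in> carrier G - H"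
    define O' where "O' = {y \<in> carrier G. inv x \<otimes> y \<in> H}"
    have "openin T O'"
      unfolding O'_def by (intro openin_preimage group_continuous_intros assms) (use x in auto)
    moreover have "x \<in> O'"
      using x assms(1) by (simp add: O'_def subgroup.one_closed)
    moreover have "O' \<subseteq> carrier G - H"
    proof
      fix y assume y: "y \<in> O'"
      have "x \<in> H" if "y \<in> H"
      proof -
        have "y \<otimes> inv (inv x \<otimes> y) \<in> H"
          using y assms(1) that by (simp add: O'_def subgroup.m_closed subgroup.m_inv_closed)
        moreover have "y \<otimes> inv (inv x \<otimes> y) = x"
          using x y by (simp add: O'_def inv_mult_group m_assoc[symmetric])
        ultimately show ?thesis by simp
      qed
      then show "y \<in> carrier G - H" using x y by (auto simp: O'_def)
    qed
    ultimately show "\<exists>O'. openin T O' \<and> x \<in> O' \<and> O' \<subseteq> carrier G - H" by blast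
  qed
  then show ?thesis
    using HG by (simp add: closedin_def topspace_eq)
qed

lemma closure_subset_carrier: "T closure_of S \<subseteq> carrier G"
  using closure_of_subset_topspace topspace_eq by metis

lemma closure_of_incl: "S \<subseteq> carrier G \<Longrightarrow> S \<subseteq> T closure_of S"
  using closure_of_subset topspace_eq by metis

lemma continuous_map_closure_mem:
  assumes "continuous_map T T f" "f ` S \<subseteq> S'" "x \<in> T closure_of S"
  shows "f x \<in> T closure_of S'"
  using continuous_map_image_closure_subset[OF assms(1), of S] closure_of_mono[OF assms(2), of T] assms(3)
  by blast

text \<open>Separate continuity is enough: moving \<open>y\<close> while the first argument stays in
  \<open>A\<close> lands in the closure of \<open>C\<close>, and then moving \<open>x\<close> lands
  in the closure of that closure.\<close>

lemma continuous_map2_closure_mem: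
  assumes "\<And>x. x \<in> carrier G \<Longrightarrow> continuous_map T T (f x)"
    and "\<And>y. y \<in> carrier G \<Longrightarrow> continuous_map T T (\<lambda>x. f x y)"
    and "A \<subseteq> carrier G" "B \<subseteq> carrier G"
    and C: "\<And>x y. x \<in> A \<Longrightarrow> y \<in> B \<Longrightarrow> f x y \<in> C"
    and x: "x \<in> T closure_of A" and y: "y \<in> T closure_of B"
  shows "f x y \<in> T closure_of C"
proof -
  have 1: "f a y \<in> T closure_of C" if "a \<in> A" for a
    by (rule continuous_map_closure_mem[OF assms(1) _ y]) (use that assms in auto)
  have "f x y \<in> T closure_of (T closure_of C)"
    by (rule continuous_map_closure_mem[OF assms(2) _ x])
      (use 1 y closure_subset_carrier in auto)
  then show ?thesis by simp
qed

lemma subgroup_closure_of: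
  assumes "subgroup H G"
  shows "subgroup (T closure_of H) G"
proof -
  have HG: "H \<subseteq> carrier G" using assms subgroup.subset by auto
  show ?thesis
  proof (rule subgroupI)
    show "T closure_of H \<subseteq> carrier G" by (rule closure_subset_carrier)
    show "T closure_of H \<noteq> {}"
      using closure_of_incl[OF HG] assms subgroup.one_closed by blast
    show "inv x \<in> T closure_of H" if "x \<in> T closure_of H" for x
      by (rule continuous_map_closure_mem[OF continuous_inv _ that])
        (use assms subgroup.m_inv_closed in auto)
    show "x \<otimes> y \<in> T closure_of H" if "x \<in> T closure_of H" "y \<in> T closure_of H" for x y
    proof (rule continuous_map2_closure_mem[OF _ _ HG HG _ that])
      show "continuous_map T T ((\<otimes>) x)" "continuous_map T T (\<lambda>y. y \<otimes> x)" if "x \<in> carrier G" for x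
        by (rule continuous_map_mult[OF continuous_map_constant[OF that] continuous_map_ident]
            continuous_map_mult[OF continuous_map_ident continuous_map_constant[OF that]])+
    qed (use subgroup.m_closed[OF assms] in auto)
  qed
qed

lemma normalizes_closure_of:
  assumes "X \<subseteq> carrier G" "normalizes X N"
  shows "normalizes X (T closure_of N)"
  unfolding normalizes_def
proof (intro ballI)
  fix x n assume "x \<in> X" "n \<in> T closure_of N"
  moreover have "conjugate x ` N \<subseteq> N"
    using assms(2) \<open>x \<in> X\<close> by (auto simp: normalizes_def)
  ultimately show "conjugate x n \<in> T closure_of N"
    using continuous_map_closure_mem[OF continuous_map_conjugate] assms(1) by blast
qed

text \<open>The coset \<open>x V\<close> is an open neighbourhood of \<open>x\<close> and so meets
  \<open>S\<close>. For dense \<open>S\<close> this gives \<open>G = S V\<close>.\<close>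

lemma closure_of_factor:
  assumes "x \<in> T closure_of S" "subgroup V G" "openin T V"
  obtains s v where "s \<in> S" "v \<in> V" "s \<in> carrier G" "x = s \<otimes> v"
proof -
  have x: "x \<in> carrier G" using assms(1) closure_subset_carrier by blast
  have VG: "V \<subseteq> carrier G" using assms(2) subgroup.subset by auto
  define O' where "O' = {y \<in> carrier G. inv x \<otimes> y \<in> V}"
  have "openin T O'"
    unfolding O'_def by (intro openin_preimage group_continuous_intros assms) (use x in auto)
  moreover have "x \<in> O'"
    using x assms(2) by (simp add: O'_def subgroup.one_closed)
  ultimately have "\<exists>s. s \<in> S \<and> s \<in> O'"
    using assms(1) by (simp add: in_closure_of)
  then obtain s where s: "s \<in> S" "s \<in> carrier G" "inv x \<otimes> s \<in> V"
    by (auto simp: O'_def)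
  show ?thesis
  proof (rule that[of s "inv (inv x \<otimes> s)"])
    show "x = s \<otimes> inv (inv x \<otimes> s)"
      using s(2) x by (simp add: inv_mult_group m_assoc[symmetric])
  qed (use s assms(2) in \<open>auto simp: subgroup.m_inv_closed\<close>)
qed

section \<open>Topological automorphisms and the density of invariant subgroups\<close>

lemma homeomorphic_map_conjugate:
  assumes "g \<in> carrier G"
  shows "homeomorphic_map T T (conjugate g)"
proof -
  have "homeomorphic_maps T T (conjugate g) (conjugate (inv g))"
    using assms by (auto simp: homeomorphic_maps_def continuous_map_conjugate topspace_eq)
  then show ?thesis
    using homeomorphic_maps_map by blast
qed

lemma conjugate_top_aut: "g \<in> carrier G \<Longrightarrow> conjugate g \<in> top_aut G T"
  by (simp add: top_aut_def conjugate_iso homeomorphic_map_conjugate)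

lemma top_aut_hom: "f \<in> top_aut G T \<Longrightarrow> f \<in> hom G G"
  by (auto simp: top_aut_def iso_def)

lemma top_aut_bij: "f \<in> top_aut G T \<Longrightarrow> bij_betw f (carrier G) (carrier G)"
  by (auto simp: top_aut_def iso_def)

lemma top_aut_closed: "\<lbrakk>f \<in> top_aut G T; x \<in> carrier G\<rbrakk> \<Longrightarrow> f x \<in> carrier G"
  using top_aut_hom by (auto simp: hom_def)

lemma top_aut_continuous: "f \<in> top_aut G T \<Longrightarrow> continuous_map T T f"
  by (simp add: top_aut_def homeomorphic_imp_continuous_map)

lemma top_aut_comp:
  assumes "f \<in> top_aut G T" "g \<in> top_aut G T"
  shows "f \<circ> g \<in> top_aut G T"
  using assms iso_set_trans[of g G G f G] homeomorphic_map_compose[of T T g T f]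
  by (auto simp: top_aut_def compose_def Group.iso_def hom_def bij_betw_trans)

lemma top_aut_inverse:
  assumes "f \<in> top_aut G T"
  obtains h where "h \<in> top_aut G T" "\<And>x. x \<in> carrier G \<Longrightarrow> f (h x) = x"
    "\<And>x. x \<in> carrier G \<Longrightarrow> h (f x) = x"
proof -
  obtain h where h: "homeomorphic_maps T T f h"
    using assms by (auto simp: top_aut_def homeomorphic_map_maps)
  have eq: "f (h x) = x" "h (f x) = x" if "x \<in> carrier G" for x
    using h that by (auto simp: homeomorphic_maps_def topspace_eq)
  have hc: "h x \<in> carrier G" if "x \<in> carrier G" for x
    using h that by (force simp: homeomorphic_maps_def topspace_eq continuous_map_def)
  have "h (x \<otimes> y) = h x \<otimes> h y" if "x \<in> carrier G" "y \<in> carrier G" for x y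
  proof -
    have "f (h x \<otimes> h y) = x \<otimes> y"
      using top_aut_hom[OF assms] that eq hc by (simp add: hom_mult)
    then show ?thesis
      using eq hc that by (metis m_closed)
  qed
  then have "h \<in> hom G G" by (auto simp: hom_def hc)
  moreover have "bij_betw h (carrier G) (carrier G)"
    by (rule bij_betwI[where g = f]) (use eq hc top_aut_closed[OF assms] in auto)
  moreover have "homeomorphic_map T T h"
    using h homeomorphic_maps_map homeomorphic_maps_sym by blast
  ultimately show ?thesis
    using that eq by (auto simp: top_aut_def iso_def)
qed

text \<open>The inverse automorphism also maps \<open>R\<close> into itself, so inclusions suffice
  when invariance is checked.\<close>

lemma top_aut_image_eqI:
  assumes "R \<subseteq> carrier G" "\<And>f. f \<in> top_aut G T \<Longrightarrow> f ` R \<subseteq> R" "f \<in> top_aut G T"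
  shows "f ` R = R"
proof
  obtain h where h: "h \<in> top_aut G T" "\<And>x. x \<in> carrier G \<Longrightarrow> f (h x) = x"
    using top_aut_inverse[OF assms(3)] by metis
  show "R \<subseteq> f ` R"
  proof
    fix x assume "x \<in> R"
    then have "x = f (h x)" "h x \<in> R" using h(2) assms(1) assms(2)[OF h(1)] by auto
    then show "x \<in> f ` R" by blast
  qed
qed (use assms in blast)

lemma top_aut_one: "f \<in> top_aut G T \<Longrightarrow> f \<one> = \<one>"
  using top_aut_hom hom_one is_group by blast

lemma top_aut_inv:
  "\<lbrakk>f \<in> top_aut G T; x \<in> carrier G\<rbrakk> \<Longrightarrow> f (inv x) = inv (f x)"
  using top_aut_hom group_hom.hom_inv[of G G f] is_group
  by (simp add: group_hom_def group_hom_axioms_def)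

lemma top_aut_mult:
  "\<lbrakk>f \<in> top_aut G T; x \<in> carrier G; y \<in> carrier G\<rbrakk> \<Longrightarrow> f (x \<otimes> y) = f x \<otimes> f y"
  using top_aut_hom hom_mult by metis

lemma top_aut_conjugate:
  "\<lbrakk>f \<in> top_aut G T; x \<in> carrier G; y \<in> carrier G\<rbrakk>
    \<Longrightarrow> f (conjugate x y) = conjugate (f x) (f y)"
  by (simp add: conjugate_def top_aut_mult top_aut_inv)

lemma top_aut_openin: "\<lbrakk>f \<in> top_aut G T; openin T W\<rbrakk> \<Longrightarrow> openin T (f ` W)"
  using homeomorphic_imp_open_map by (fastforce simp: top_aut_def open_map_def)

lemma top_aut_compactin: "\<lbrakk>f \<in> top_aut G T; compactin T C\<rbrakk> \<Longrightarrow> compactin T (f ` C)"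
  using image_compactin top_aut_continuous by blast

lemma top_aut_subgroup: "\<lbrakk>f \<in> top_aut G T; subgroup H G\<rbrakk> \<Longrightarrow> subgroup (f ` H) G"
  using top_aut_hom group_hom.subgroup_img_is_subgroup[of G G f] is_group
  by (simp add: group_hom_def group_hom_axioms_def)

lemma top_char_simple_dense:
  assumes simple: "top_char_simple G T" and R: "subgroup R G" "R \<noteq> {\<one>}"
    and inv: "\<And>f. f \<in> top_aut G T \<Longrightarrow> f ` R \<subseteq> R"
  shows "T closure_of R = carrier G"
proof -
  have RG: "R \<subseteq> carrier G" using R subgroup.subset by auto
  have "f ` (T closure_of R) = T closure_of R" if f: "f \<in> top_aut G T" for f
  proof -
    have "f ` R = R" using top_aut_image_eqI[OF RG inv f] .
    then show ?thesis
      using homeomorphic_map_closure_of[of T T f R] f RG by (simp add: top_aut_def topspace_eq)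
  qed
  moreover have "T closure_of R \<noteq> {\<one>}"
    using closure_of_incl[OF RG] R subgroup.one_closed by fastforce
  ultimately show ?thesis
    using simple subgroup_closure_of[OF R(1)] closedin_closure_of[of T R]
    unfolding top_char_simple_def by blast
qed

text \<open>The subgroups generated by \<open>U\<close> and a finite subset of \<open>D\<close> are
  open, and they cover \<open>G\<close> because a word uses finitely many letters. Finitely many of
  them cover the compact generating set, and the union of their finite subsets does the job.\<close>

lemma finite_generation_over_open:
  assumes cg: "compactly_generated G T" and U: "subgroup U G" "openin T U"
    and D: "D \<subseteq> carrier G" "generate G (U \<union> D) = carrier G"
  obtains F where "finite F" "F \<subseteq> D" "generate G (U \<union> F) = carrier G"
proof -
  obtain K where K: "compactin T K" "generate G K = carrier G"
    using cg by (auto simp: compactly_generated_def)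
  have UG: "U \<subseteq> carrier G" using U subgroup.subset by auto
  define \<U> where "\<U> = (\<lambda>F. generate G (U \<union> F)) ` {F. finite F \<and> F \<subseteq> D}"
  have opn: "openin T X" if "X \<in> \<U>" for X
  proof -
    obtain F where F: "F \<subseteq> D" "X = generate G (U \<union> F)" using \<open>X \<in> \<U>\<close> by (auto simp: \<U>_def)
    have "subgroup X G" using F D UG by (auto intro!: generate_is_subgroup)
    moreover have "U \<subseteq> X" using F(2) by (auto intro: generate.incl)
    ultimately show ?thesis
      using open_subgroupI[OF _ U(2)] U(1) subgroup.one_closed by blast
  qed
  have ex: "\<exists>F. finite F \<and> F \<subseteq> D \<and> g \<in> generate G (U \<union> F)" if "g \<in> generate G (U \<union> D)" for g
    using that
  proof (induction rule: generate.induct)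
    case one
    then show ?case using generate.one by blast
  next
    case (incl h)
    \<comment> \<open>\<open>{h} \<inter> D\<close> is empty when \<open>h\<close> lies outside
      \<open>D\<close>, hence in \<open>U\<close>; this treats both kinds of generators
      together.\<close>
    then have "h \<in> generate G (U \<union> ({h} \<inter> D))" by (auto intro: generate.incl)
    then show ?case by (meson Int_lower2 finite.emptyI finite_Int finite_insert)
  next
    case (inv h)
    then have "inv h \<in> generate G (U \<union> ({h} \<inter> D))" by (auto intro: generate.inv)
    then show ?case by (meson Int_lower2 finite.emptyI finite_Int finite_insert)
  next
    case (eng h1 h2)
    then obtain F1 F2 where F: "finite F1" "F1 \<subseteq> D" "h1 \<in> generate G (U \<union> F1)"
      "finite F2" "F2 \<subseteq> D" "h2 \<in> generate G (U \<union> F2)" by blast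
    then have "h1 \<in> generate G (U \<union> (F1 \<union> F2))" "h2 \<in> generate G (U \<union> (F1 \<union> F2))"
      using mono_generate[of "U \<union> F1" "U \<union> (F1 \<union> F2)"] mono_generate[of "U \<union> F2" "U \<union> (F1 \<union> F2)"]
      by blast+
    then have "h1 \<otimes> h2 \<in> generate G (U \<union> (F1 \<union> F2))" by (rule generate.eng)
    then show ?case using F by (metis Un_least finite_UnI)
  qed
  have "K \<subseteq> \<Union>\<U>"
  proof
    fix k assume "k \<in> K"
    then have "k \<in> generate G (U \<union> D)"
      using K(1) D(2) compactin_subset_topspace topspace_eq by blast
    from ex[OF this] show "k \<in> \<Union>\<U>" by (auto simp: \<U>_def)
  qed
  then obtain \<F> where \<F>: "finite \<F>" "\<F> \<subseteq> \<U>" "K \<subseteq> \<Union>\<F>"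
    using K(1) opn unfolding compactin_def by meson
  then obtain \<C> where \<C>: "\<C> \<subseteq> {F. finite F \<and> F \<subseteq> D}" "finite \<C>"
    "\<F> = (\<lambda>F. generate G (U \<union> F)) ` \<C>"
    using finite_subset_image[OF \<F>(1) \<F>(2)[unfolded \<U>_def]] by blast
  show ?thesis
  proof (rule that[of "\<Union>\<C>"])
    show "finite (\<Union>\<C>)" "\<Union>\<C> \<subseteq> D" using \<C> by auto
    have sub: "subgroup (generate G (U \<union> \<Union>\<C>)) G"
      using \<C> D UG by (intro generate_is_subgroup) blast
    have "K \<subseteq> generate G (U \<union> \<Union>\<C>)"
    proof
      fix k assume "k \<in> K"
      then obtain F where "F \<in> \<C>" "k \<in> generate G (U \<union> F)" using \<F>(3) \<C>(3) by auto
      then show "k \<in> generate G (U \<union> \<Union>\<C>)"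
        using mono_generate[of "U \<union> F" "U \<union> \<Union>\<C>"] by blast
    qed
    then have "carrier G \<subseteq> generate G (U \<union> \<Union>\<C>)"
      using generate_subgroup_incl[OF _ sub] K(2) by blast
    then show "generate G (U \<union> \<Union>\<C>) = carrier G"
      using sub subgroup.subset by blast
  qed
qed

end

lemma (in group) set_mult_incl:
  assumes "A \<subseteq> carrier G" "B \<subseteq> carrier G"
  shows "\<one> \<in> B \<Longrightarrow> A \<subseteq> A <#> B" "\<one> \<in> A \<Longrightarrow> B \<subseteq> A <#> B"
proof -
  show "A \<subseteq> A <#> B" if "\<one> \<in> B"
  proof
    fix a assume "a \<in> A"
    moreover have "a = a \<otimes> \<one>" using calculation assms by auto
    ultimately show "a \<in> A <#> B" using that unfolding set_mult_def by blast
  qed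
  show "B \<subseteq> A <#> B" if "\<one> \<in> A"
  proof
    fix b assume "b \<in> B"
    moreover have "b = \<one> \<otimes> b" using calculation assms by auto
    ultimately show "b \<in> A <#> B" using that unfolding set_mult_def by blast
  qed
qed

section \<open>Totally disconnected locally compact groups\<close>

locale tdlc_group = topological_group +
  assumes locally_compact: "locally_compact_space T"
    and totally_disconnected: "totally_disconnected_space T"
begin

text \<open>In a compact Hausdorff neighbourhood \<open>C\<close> components agree with
  quasi-components, so the clopen subsets of \<open>C\<close> containing the identity intersect in a
  point. By compactness finitely many of them already avoid the part of \<open>C\<close> outside
  \<open>O' \<inter> W\<close>.\<close>

lemma compact_open_neighbourhood:
  assumes W: "openin T W" "\<one> \<in> W"
  obtains D where "openin T D" "compactin T D" "\<one> \<in> D" "D \<subseteq> W"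
proof -
  obtain O' C where O': "openin T O'" and C: "compactin T C" and one: "\<one> \<in> O'" "O' \<subseteq> C"
    using locally_compact W topspace_eq unfolding locally_compact_space_def by (metis one_closed)
  define X where "X = subtopology T C"
  have topX: "topspace X = C"
    using compactin_subset_topspace[OF C] unfolding X_def by (simp add: inf.absorb2)
  have cX: "compact_space X" "Hausdorff_space X"
    using C Hausdorff unfolding X_def
    by (simp_all add: compactin_subspace Hausdorff_space_subtopology)
  have "connected_component_of_set X \<one> \<subseteq> {\<one>}"
  proof
    fix y assume "y \<in> connected_component_of_set X \<one>"
    then have "connected_component_of T \<one> y"
      using connected_component_of_mono[of T C \<one> y "topspace T"]
      by (auto simp: X_def connected_component_of_def connectedin_subtopology)
    then show "y \<in> {\<one>}"
      using totally_disconnected topspace_eq unfolding totally_disconnected_space_def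
      by (metis mem_Collect_eq one_closed)
  qed
  moreover have "quasi_component_of X \<one> = connected_component_of X \<one>"
    by (rule quasi_eq_connected_component_of) (use cX in simp)
  moreover have "\<one> \<in> topspace X" using one topX by auto
  ultimately have Q: "\<Inter> {t. closedin X t \<and> openin X t \<and> \<one> \<in> t} \<subseteq> {\<one>}"
    using quasi_component_of_set[of X \<one>] by auto
  define P where "P = {t. closedin X t \<and> openin X t \<and> \<one> \<in> t}"
  have P0: "C \<in> P" using one topX by (auto simp: P_def openin_topspace[of X, simplified topX]
      closedin_topspace[of X, simplified topX])
  define S where "S = C - (O' \<inter> W)"
  have "closedin X S"
  proof -
    have "openin X (C \<inter> (O' \<inter> W))"
      unfolding X_def by (simp add: openin_subtopology_Int2 O' W(1) openin_Int)
    then have "closedin X (topspace X - C \<inter> (O' \<inter> W))" by blast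
    then show ?thesis by (simp add: topX S_def Diff_Int_distrib Diff_Int Un_commute)
  qed
  then have "compactin X S"
    using cX closedin_compact_space by blast
  moreover have "\<forall>t\<in>(\<lambda>t. C - t) ` P. openin X t"
    by (auto simp: P_def topX[symmetric])
  moreover have "S \<subseteq> \<Union> ((\<lambda>t. C - t) ` P)"
    using Q W one by (auto simp: P_def S_def)
  ultimately obtain \<F> where \<F>: "finite \<F>" "\<F> \<subseteq> (\<lambda>t. C - t) ` P" "S \<subseteq> \<Union>\<F>"
    unfolding compactin_def by meson
  then obtain \<P> where \<P>: "finite \<P>" "\<P> \<subseteq> P" "\<F> = (\<lambda>t. C - t) ` \<P>"
    using finite_subset_image[OF \<F>(1,2)] by blast
  define D where "D = \<Inter> (insert C \<P>)"
  have fin: "finite (insert C \<P>)" "insert C \<P> \<noteq> {}" "insert C \<P> \<subseteq> P" using \<P> P0 by auto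
  have Dcl: "closedin X D" unfolding D_def using fin P_def by (intro closedin_Inter) auto
  have Dop: "openin X D" unfolding D_def using fin P_def by (intro openin_Inter) auto
  have oneD: "\<one> \<in> D" using fin by (auto simp: D_def P_def)
  have DW: "D \<subseteq> O' \<inter> W" using \<F>(3) \<P>(3) by (auto simp: D_def S_def)
  obtain O2 where O2: "openin T O2" "D = O2 \<inter> C"
    using Dop unfolding X_def by (auto simp: openin_subtopology)
  \<comment> \<open>So far \<open>D\<close> is open only relative to \<open>C\<close>. Since it lies
    in \<open>O'\<close>, an open subset of \<open>C\<close>, it is open in
    \<open>T\<close>.\<close>
  have "D = O2 \<inter> O'" using O2 DW one by blast
  then have "openin T D" using O2 O' by auto
  moreover have "compactin T D"
    using closedin_compact_space[OF cX(1) Dcl] unfolding X_def by (simp add: compactin_subtopology)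
  ultimately show ?thesis using that oneD DW by blast
qed

text \<open>Van Dantzig: if \<open>D V \<subseteq> D\<close> for a neighbourhood \<open>V\<close> of the identity,
  then \<open>D\<close> contains the subgroup generated by \<open>V\<close>.\<close>

lemma compact_open_subgroup:
  assumes W: "openin T W" "\<one> \<in> W"
  obtains V where "subgroup V G" "openin T V" "compactin T V" "V \<subseteq> W"
proof -
  obtain D where D: "openin T D" "compactin T D" "\<one> \<in> D" "D \<subseteq> W"
    using compact_open_neighbourhood[OF W] .
  have DG: "D \<subseteq> carrier G" using D openin_subset_carrier by blast
  define M where "M = {p \<in> topspace (prod_topology T T). (\<lambda>(x, y). x \<otimes> y) p \<in> D}"
  have "openin (prod_topology T T) M"
    unfolding M_def by (rule openin_continuous_map_preimage[OF continuous_mult D(1)])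
  moreover have "D \<times> {\<one>} \<subseteq> M"
    using DG by (auto simp: M_def topspace_eq)
  ultimately obtain A B where AB: "openin T A" "openin T B" "D \<subseteq> A" "\<one> \<in> B" "A \<times> B \<subseteq> M"
    using tube_lemma_left[OF _ D(2)] topspace_eq by (metis one_closed)
  \<comment> \<open>\<open>B\<close> is symmetrised so that right multiplication by the inverses of
    generators also preserves \<open>D\<close>.\<close>
  define S where "S = B \<inter> {x \<in> carrier G. inv x \<in> B}"
  have S: "openin T S" "\<one> \<in> S" "S \<subseteq> carrier G"
    unfolding S_def using AB openin_preimage[OF continuous_inv] by auto
  have step: "d \<otimes> s \<in> D" "d \<otimes> inv s \<in> D" if "d \<in> D" "s \<in> S" for d s
  proof -
    have "(d, s) \<in> M" "(d, inv s) \<in> M" using that AB(3,5) unfolding S_def by blast+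
    then show "d \<otimes> s \<in> D" "d \<otimes> inv s \<in> D" by (simp_all add: M_def)
  qed
  have "d \<otimes> x \<in> D" if "x \<in> generate G S" "d \<in> D" for x d
    using that
  proof (induction arbitrary: d rule: generate.induct)
    case one
    then show ?case using DG by auto
  next
    case (incl h)
    then show ?case using step by blast
  next
    case (inv h)
    then show ?case using step by blast
  next
    case (eng h1 h2)
    then have "(d \<otimes> h1) \<otimes> h2 \<in> D" by blast
    then show ?case
      using eng generate_in_carrier[OF S(3)] DG by (metis m_assoc subsetD)
  qed
  then have "generate G S \<subseteq> D"
    using D(3) generate_in_carrier[OF S(3)] by (metis l_one subsetI)
  moreover have sub: "subgroup (generate G S) G"
    using S by (intro generate_is_subgroup)
  moreover have opn: "openin T (generate G S)"
    by (rule open_subgroupI[OF sub S(1,2)]) (auto intro: generate.incl)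
  moreover have "compactin T (generate G S)"
    using closed_compactin[OF D(2)] calculation closedin_open_subgroup by blast
  ultimately show ?thesis using that D(4) by blast
qed

text \<open>The factor \<open>carrier G\<close> makes the empty family yield the whole
  group.\<close>

lemma finite_Inter_open_subgroups:
  assumes "finite I" "\<And>i. i \<in> I \<Longrightarrow> subgroup (V i) G \<and> openin T (V i)"
  shows "subgroup (carrier G \<inter> (\<Inter>i\<in>I. V i)) G \<and> openin T (carrier G \<inter> (\<Inter>i\<in>I. V i))"
  using assms
proof (induction rule: finite_induct)
  case empty
  then show ?case by (simp add: subgroup_self)
next
  case (insert i I)
  then have "subgroup (V i \<inter> (carrier G \<inter> (\<Inter>i\<in>I. V i))) G
      \<and> openin T (V i \<inter> (carrier G \<inter> (\<Inter>i\<in>I. V i)))"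
    using subgroups_Inter_pair openin_Int by auto
  then show ?case by (simp add: inf.left_commute)
qed

text \<open>Finitely many cosets \<open>V' f\<close> with \<open>f\<close> in \<open>U\<close> cover
  the compact \<open>U\<close>, and whether \<open>conjugate u x\<close> lies in \<open>V'\<close>
  depends only on the coset \<open>V' u\<close>. So the intersection over all \<open>u\<close> in
  \<open>U\<close> that defines \<open>V\<close> contains a finite, hence open,
  intersection.\<close>

lemma open_normal_core:
  assumes U: "subgroup U G" "compactin T U" and W: "openin T W" "\<one> \<in> W" and UO: "openin T U"
  obtains V where "subgroup V G" "openin T V" "V \<subseteq> W" "V \<subseteq> U" "normalizes U V"
proof -
  have "openin T (W \<inter> U)" "\<one> \<in> W \<inter> U"
    using W U UO subgroup.one_closed by auto
  then obtain V' where V': "subgroup V' G" "openin T V'" "V' \<subseteq> W \<inter> U"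
    using compact_open_subgroup by metis
  have UG: "U \<subseteq> carrier G" and V'G: "V' \<subseteq> carrier G"
    using U V' subgroup.subset by auto
  define c where "c f = {y \<in> carrier G. y \<otimes> inv f \<in> V'}" for f
  have "openin T (c f)" if "f \<in> U" for f
    unfolding c_def by (intro openin_preimage group_continuous_intros V') (use that UG in auto)
  moreover have "U \<subseteq> \<Union> (c ` U)"
  proof
    fix u assume "u \<in> U"
    then have "u \<in> c u" using UG V'(1) by (auto simp: c_def subgroup.one_closed)
    then show "u \<in> \<Union> (c ` U)" using \<open>u \<in> U\<close> by blast
  qed
  moreover have "\<forall>W\<in>c ` U. openin T W" using calculation by blast
  ultimately obtain \<F> where \<F>: "finite \<F>" "\<F> \<subseteq> c ` U" "U \<subseteq> \<Union>\<F>"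
    using U(2) unfolding compactin_def by meson
  then obtain F where F: "finite F" "F \<subseteq> U" "\<F> = c ` F"
    using finite_subset_image[OF \<F>(1,2)] by blast
  define V where "V = {x \<in> carrier G. \<forall>u\<in>U. conjugate u x \<in> V'}"
  have sub: "subgroup V G"
  proof (rule subgroupI)
    show "V \<noteq> {}"
      using UG V'(1) by (auto simp: V_def subgroup.one_closed intro!: exI[of _ \<one>])
    show "inv a \<in> V" if "a \<in> V" for a
      using that UG V'(1) by (auto simp: V_def conjugate_inv subgroup.m_inv_closed subset_iff)
    show "a \<otimes> b \<in> V" if "a \<in> V" "b \<in> V" for a b
      using that UG V'(1) by (auto simp: V_def conjugate_mult subgroup.m_closed subset_iff)
  qed (auto simp: V_def)
  define O' where "O' = carrier G \<inter> (\<Inter>f\<in>F. {x \<in> carrier G. conjugate f x \<in> V'})"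
  have "openin T O'"
    unfolding O'_def
    using openin_INT[OF F(1), of T "\<lambda>f. {x \<in> carrier G. conjugate f x \<in> V'}"]
      openin_preimage[OF continuous_map_conjugate V'(2)] F(2) UG
    by (auto simp: topspace_eq Int_commute)
  moreover have "\<one> \<in> O'"
    using F UG V'(1) by (auto simp: O'_def subgroup.one_closed subset_iff)
  moreover have "O' \<subseteq> V"
  proof
    fix x assume x: "x \<in> O'"
    have "conjugate u x \<in> V'" if "u \<in> U" for u
    proof -
      obtain f where f: "f \<in> F" "u \<otimes> inv f \<in> V'"
        using \<F>(3) F(3) \<open>u \<in> U\<close> by (auto simp: c_def)
      have "conjugate (u \<otimes> inv f) (conjugate f x) \<in> V'"
        by (rule normalizesD[OF subgroup_normalizes[OF V'(1)]]) (use f x in \<open>auto simp: O'_def\<close>)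
      moreover have "conjugate (u \<otimes> inv f) (conjugate f x) = conjugate u x"
        using f F UG that x
        by (subst conjugate_conjugate) (auto simp: O'_def m_assoc subset_iff)
      ultimately show ?thesis by simp
    qed
    then show "x \<in> V" using x by (auto simp: V_def O'_def)
  qed
  ultimately have "openin T V" using open_subgroupI[OF sub] by blast
  moreover have "V \<subseteq> V'"
    using U(1) by (force simp: V_def dest: subgroup.one_closed)
  moreover have "normalizes U V"
    using UG U(1) by (auto simp: normalizes_def V_def conjugate_conjugate subset_iff subgroup.m_closed)
  ultimately show ?thesis using that sub V'(3) by blast
qed

end

section \<open>Compactly generated, topologically characteristically simple groups and part
  (i)\<close>

locale cg_char_simple_tdlc_group = tdlc_group +
  fixes U
  assumes compactly_generated: "compactly_generated G T"
    and char_simple: "top_char_simple G T"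
    and not_discrete: "T \<noteq> discrete_topology (carrier G)"
    and not_compact: "\<not> compact_space T"
    and subgroup_U: "subgroup U G" and open_U: "openin T U" and compact_U: "compactin T U"
begin

lemma U_subset: "U \<subseteq> carrier G"
  using subgroup_U subgroup.subset by blast

lemma open_normal_in_U:
  assumes "openin T W" "\<one> \<in> W"
  obtains V where "subgroup V G" "openin T V" "V \<subseteq> W" "V \<subseteq> U" "normalizes U V"
  using open_normal_core[OF subgroup_U compact_U assms open_U] .

text \<open>Density becomes generation because the open subgroup \<open>U\<close> absorbs the
  closure. An invariant set is allowed in place of a subgroup, so that the finitely many generators
  can be taken from the set itself, for example from an orbit of automorphisms.\<close>

lemma char_set_generates:
  assumes D: "D \<subseteq> carrier G" "x \<in> D" "x \<noteq> \<one>"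
    and inv: "\<And>f. f \<in> top_aut G T \<Longrightarrow> f ` D \<subseteq> D"
  obtains F where "finite F" "F \<subseteq> D" "generate G (U \<union> F) = carrier G"
proof -
  have "f ` generate G D \<subseteq> generate G D" if "f \<in> top_aut G T" for f
    using hom_generate_subset[OF top_aut_hom[OF that] D(1) generate_is_subgroup[OF D(1)]]
      inv[OF that] by (auto intro: generate.incl)
  moreover have "generate G D \<noteq> {\<one>}"
    using D generate.incl by fastforce
  ultimately have dense: "T closure_of generate G D = carrier G"
    using top_char_simple_dense[OF char_simple generate_is_subgroup[OF D(1)]] by blast
  have sub: "subgroup (generate G (U \<union> D)) G"
    using U_subset D(1) by (intro generate_is_subgroup) blast
  have "carrier G \<subseteq> generate G (U \<union> D)"
  proof
    fix g assume "g \<in> carrier G"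
    then obtain s v where "s \<in> generate G D" "v \<in> U" "g = s \<otimes> v"
      using closure_of_factor[OF _ subgroup_U open_U] dense by metis
    moreover have "s \<in> generate G (U \<union> D)"
      using \<open>s \<in> generate G D\<close> mono_generate[of D "U \<union> D"] by blast
    ultimately show "g \<in> generate G (U \<union> D)"
      by (auto intro: generate.eng generate.incl)
  qed
  then have "generate G (U \<union> D) = carrier G"
    using sub subgroup.subset by blast
  then show ?thesis
    using finite_generation_over_open[OF compactly_generated subgroup_U open_U D(1)] that by blast
qed

text \<open>\<open>N\<close> need not be invariant under automorphisms, but the union of all
  relatively compact normal subgroups is. Finitely many of its elements lie in a product
  \<open>M\<close> of finitely many such subgroups, which is of the same kind; if they generate
  \<open>G\<close> with \<open>U\<close>, then \<open>G = M U\<close> is compact.\<close>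

lemma no_relatively_compact_normal:
  assumes N: "N \<lhd> G" "N \<subseteq> C" "compactin T C"
  shows "N = {\<one>}"
proof (rule ccontr)
  assume "N \<noteq> {\<one>}"
  define rc where "rc M \<longleftrightarrow> M \<lhd> G \<and> (\<exists>C. compactin T C \<and> M \<subseteq> C)" for M
  define D where "D = \<Union> (Collect rc)"
  have rc_sub: "M \<subseteq> carrier G" if "rc M" for M
    using that by (auto simp: rc_def dest!: normal_imp_subgroup subgroup.mem_carrier)
  have prod_compact: "compactin T (C1 <#> C2)" if "compactin T C1" "compactin T C2" for C1 C2
  proof -
    have "compactin T ((\<lambda>(x, y). x \<otimes> y) ` (C1 \<times> C2))"
      using image_compactin[OF _ continuous_mult] that compactin_Times by blast
    moreover have "(\<lambda>(x, y). x \<otimes> y) ` (C1 \<times> C2) = C1 <#> C2"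
      by (auto simp: set_mult_def)
    ultimately show ?thesis by simp
  qed
  have rc_mult: "rc (M1 <#> M2)" if "rc M1" "rc M2" for M1 M2
  proof -
    obtain C1 C2 where C: "compactin T C1" "M1 \<subseteq> C1" "compactin T C2" "M2 \<subseteq> C2"
      using \<open>rc M1\<close> \<open>rc M2\<close> unfolding rc_def by blast
    have "M1 <#> M2 \<subseteq> C1 <#> C2" using C by (auto simp: set_mult_def)
    moreover have "M1 <#> M2 \<lhd> G"
      unfolding normal_iff_normalizes
    proof
      show "subgroup (M1 <#> M2) G"
        using that mult_norm_subgroup normal_imp_subgroup by (auto simp: rc_def)
      have "conjugate g (m1 \<otimes> m2) \<in> M1 <#> M2" if "g \<in> carrier G" "m1 \<in> M1" "m2 \<in> M2" for g m1 m2
      proof -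
        have "conjugate g m1 \<in> M1" "conjugate g m2 \<in> M2"
          using that \<open>rc M1\<close> \<open>rc M2\<close> by (auto simp: rc_def normal_iff_normalizes normalizes_def)
        moreover have "conjugate g (m1 \<otimes> m2) = conjugate g m1 \<otimes> conjugate g m2"
          using that rc_sub[OF \<open>rc M1\<close>] rc_sub[OF \<open>rc M2\<close>] by (auto intro!: conjugate_mult)
        ultimately show ?thesis by (auto simp: set_mult_def)
      qed
      then show "normalizes (carrier G) (M1 <#> M2)"
        by (auto simp: normalizes_def set_mult_def)
    qed
    ultimately show ?thesis using prod_compact C unfolding rc_def by blast
  qed
  have rc_img: "rc (f ` M)" if f: "f \<in> top_aut G T" and "rc M" for f M
  proof -
    have "subgroup (f ` M) G"
      using that top_aut_subgroup by (auto simp: rc_def dest: normal_imp_subgroup)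
    moreover have "normalizes (carrier G) (f ` M)"
      unfolding normalizes_def
    proof (intro ballI)
      fix g n assume g: "g \<in> carrier G" and "n \<in> f ` M"
      then obtain m where m: "m \<in> M" "n = f m" by blast
      obtain h where h: "h \<in> carrier G" "g = f h"
        using top_aut_bij[OF f] g by (auto simp: bij_betw_def)
      have "conjugate g n = f (conjugate h m)"
        using top_aut_conjugate[OF f] m h rc_sub[OF \<open>rc M\<close>] by auto
      then show "conjugate g n \<in> f ` M"
        using m h \<open>rc M\<close> by (auto simp: rc_def normal_iff_normalizes normalizes_def)
    qed
    ultimately show ?thesis
      using that top_aut_compactin[OF f] by (auto simp: rc_def normal_iff_normalizes)
  qed
  obtain x where "x \<in> N" "x \<noteq> \<one>"
    using \<open>N \<noteq> {\<one>}\<close> N(1) normal_imp_subgroup subgroup.one_closed by fastforce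
  moreover have "x \<in> D" using N \<open>x \<in> N\<close> by (auto simp: D_def rc_def)
  moreover have "D \<subseteq> carrier G" using rc_sub by (auto simp: D_def)
  moreover have "f ` D \<subseteq> D" if "f \<in> top_aut G T" for f
    using rc_img[OF that] by (auto simp: D_def)
  ultimately obtain F where F: "finite F" "F \<subseteq> D" "generate G (U \<union> F) = carrier G"
    using char_set_generates[of D x] by blast
  have "\<exists>M. rc M \<and> F \<subseteq> M"
    using F(1,2)
  proof (induction rule: finite_induct)
    case empty
    then show ?case using N by (auto simp: rc_def)
  next
    case (insert a F)
    then obtain M M' where M: "rc M" "F \<subseteq> M" "rc M'" "a \<in> M'" by (auto simp: D_def)
    have ones: "\<one> \<in> M" "\<one> \<in> M'"
      using M by (auto simp: rc_def dest!: normal_imp_subgroup subgroup.one_closed)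
    then have "M \<subseteq> M <#> M'" "M' \<subseteq> M <#> M'"
      using set_mult_incl[OF rc_sub[OF M(1)] rc_sub[OF M(3)]] by auto
    then have "insert a F \<subseteq> M <#> M'" using M(2,4) by blast
    then show ?case using rc_mult[OF M(1,3)] by blast
  qed
  then obtain M where M: "rc M" "F \<subseteq> M" by blast
  then obtain C' where C': "compactin T C'" "M \<subseteq> C'" by (auto simp: rc_def)
  have sub: "subgroup (M <#> U) G"
    using M mult_norm_subgroup subgroup_U by (auto simp: rc_def)
  have "U \<union> F \<subseteq> M <#> U"
  proof -
    have ones: "\<one> \<in> M" "\<one> \<in> U"
      using M subgroup_U by (auto simp: rc_def subgroup.one_closed dest!: normal_imp_subgroup)
    then show ?thesis
      using set_mult_incl[OF rc_sub[OF M(1)] U_subset] M(2) by blast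
  qed
  then have "carrier G \<subseteq> M <#> U"
    using generate_subgroup_incl[OF _ sub] F(3) by blast
  also have "\<dots> \<subseteq> C' <#> U" using C' by (auto simp: set_mult_def)
  finally have "C' <#> U = carrier G"
    using prod_compact[OF C'(1) compact_U] compactin_subset_topspace topspace_eq by blast
  then show False
    using prod_compact[OF C'(1) compact_U] not_compact topspace_eq by (simp add: compact_space_def)
qed

lemma not_open_singleton: "\<not> openin T {\<one>}"
proof
  assume one: "openin T {\<one>}"
  have "openin T {g}" if g: "g \<in> carrier G" for g
  proof -
    have "openin T {x \<in> carrier G. inv g \<otimes> x \<in> {\<one>}}"
      by (intro openin_preimage group_continuous_intros one) (use g in auto)
    moreover have "{x \<in> carrier G. inv g \<otimes> x \<in> {\<one>}} = {g}"
      using g inv_solve_left' by fastforce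
    ultimately show ?thesis by simp
  qed
  then have "T = discrete_topology (carrier G)"
    using discrete_topology_unique topspace_eq by metis
  then show False using not_discrete by blast
qed

text \<open>\<open>N\<close> is normalised by generators of \<open>G\<close>, and it is relatively
  compact because \<open>U\<close> is compact.\<close>

lemma normal_in_U_trivial:
  assumes gen: "generate G (U \<union> F) = carrier G" "F \<subseteq> carrier G"
    and N: "subgroup N G" "N \<subseteq> U" "normalizes U N"
    and F: "normalizes F N" "normalizes (m_inv G ` F) N"
  shows "N = {\<one>}"
proof -
  have "m_inv G ` U \<subseteq> U"
    using subgroup_U subgroup.m_inv_closed by fastforce
  then have "normalizes (generate G (U \<union> F)) N"
    using N F gen U_subset by (intro generate_normalizes) (auto simp: normalizes_def)
  then show ?thesis
    using no_relatively_compact_normal[OF _ N(2) compact_U] N(1) gen(1)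
    by (simp add: normal_iff_normalizes)
qed

lemma centralized_in_U_trivial:
  assumes gen: "generate G (U \<union> F) = carrier G" "F \<subseteq> carrier G"
    and N: "subgroup N G" "N \<subseteq> U" "normalizes U N"
    and F: "\<And>f n. \<lbrakk>f \<in> F; n \<in> N\<rbrakk> \<Longrightarrow> f \<otimes> n = n \<otimes> f"
  shows "N = {\<one>}"
proof (rule normal_in_U_trivial[OF gen N])
  have NG: "N \<subseteq> carrier G" using N U_subset by blast
  show "normalizes F N" "normalizes (m_inv G ` F) N"
    using F NG gen(2) by (auto intro!: normalizes_commuting commute_inv)
qed

text \<open>Automorphisms carry centralisers to centralisers and open sets to open sets, so the
  elements with open centraliser form an invariant set. The argument ends with an open trivial
  subgroup, which is excluded because \<open>G\<close> is not discrete.\<close>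

theorem open_centralizer_trivial:
  assumes x: "x \<in> carrier G" "openin T (centralizer G x)"
  shows "x = \<one>"
proof (rule ccontr)
  assume "x \<noteq> \<one>"
  define D where "D = {x \<in> carrier G. openin T (centralizer G x)}"
  have "f ` D \<subseteq> D" if f: "f \<in> top_aut G T" for f
  proof safe
    fix y assume y: "y \<in> D"
    have "centralizer G (f y) = f ` centralizer G y"
    proof
      have yG: "y \<in> carrier G" using y by (auto simp: D_def)
      show "f ` centralizer G y \<subseteq> centralizer G (f y)"
      proof
        fix g assume "g \<in> f ` centralizer G y"
        then obtain h where h: "h \<in> carrier G" "h \<otimes> y = y \<otimes> h" "g = f h"
          by (auto simp: centralizer_def)
        then show "g \<in> centralizer G (f y)"
          using yG top_aut_closed[OF f] top_aut_mult[OF f, of h y] top_aut_mult[OF f, of y h]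
          by (simp add: centralizer_def)
      qed
      show "centralizer G (f y) \<subseteq> f ` centralizer G y"
      proof
        fix g assume g: "g \<in> centralizer G (f y)"
        then obtain h where h: "h \<in> carrier G" "g = f h"
          using top_aut_bij[OF f] by (auto simp: bij_betw_def centralizer_def)
        then have "f (h \<otimes> y) = f (y \<otimes> h)"
          using g yG by (simp add: centralizer_def top_aut_mult[OF f])
        then have "h \<otimes> y = y \<otimes> h"
          using top_aut_bij[OF f] h yG by (auto simp: bij_betw_def inj_on_def)
        then show "g \<in> f ` centralizer G y" using h by (auto simp: centralizer_def)
      qed
    qed
    then show "f y \<in> D"
      using y top_aut_openin[OF f] top_aut_closed[OF f] by (auto simp: D_def)
  qed
  moreover have "D \<subseteq> carrier G" "x \<in> D" using x by (auto simp: D_def)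
  ultimately obtain F where F: "finite F" "F \<subseteq> D" "generate G (U \<union> F) = carrier G"
    using char_set_generates[of D x] \<open>x \<noteq> \<one>\<close> by blast
  define W where "W = carrier G \<inter> (\<Inter>f\<in>F. centralizer G f)"
  have "openin T W"
    using openin_INT[OF F(1), of T "centralizer G"] F(2)
    by (auto simp: D_def W_def topspace_eq Int_commute)
  moreover have "\<one> \<in> W" using F by (auto simp: W_def centralizer_def D_def)
  ultimately obtain V where V: "subgroup V G" "openin T V" "V \<subseteq> W" "V \<subseteq> U" "normalizes U V"
    using open_normal_in_U by metis
  have "V = {\<one>}"
    by (rule centralized_in_U_trivial[OF F(3) _ V(1,4,5)])
      (use F V(3) in \<open>auto simp: D_def W_def centralizer_def\<close>)
  then show False using V(2) not_open_singleton by simp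
qed

end

section \<open>Products of abelian normal subgroups\<close>

context group
begin

text \<open>Indices start at 0, so \<open>lower_central M k\<close> is the term usually numbered
  \<open>k + 1\<close>. Working with subsets of \<open>G\<close> keeps the terms for different
  \<open>M\<close> inside one group, where they can be compared.\<close>

primrec lower_central :: "'a set \<Rightarrow> nat \<Rightarrow> 'a set" where
  "lower_central M 0 = M"
| "lower_central M (Suc k) = generate G {commutator x y |x y. x \<in> lower_central M k \<and> y \<in> M}"

lemma lower_central_subgroup:
  assumes "subgroup M G"
  shows "subgroup (lower_central M k) G \<and> lower_central M k \<subseteq> M"
proof (induction k)
  case 0
  then show ?case using assms by simp
next
  case (Suc k)
  have "{commutator x y |x y. x \<in> lower_central M k \<and> y \<in> M} \<subseteq> M"
    using Suc assms by (auto simp: commutator_def subgroup.m_closed subgroup.m_inv_closed subset_iff)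
  moreover have "subgroup (lower_central M (Suc k)) G"
    unfolding lower_central.simps
    by (rule generate_is_subgroup) (use calculation subgroup.subset[OF assms] in blast)
  ultimately show ?case
    using generate_subgroup_incl[OF _ assms] by simp
qed

lemma hom_commutator:
  assumes "f \<in> hom G G" "x \<in> carrier G" "y \<in> carrier G"
  shows "f (commutator x y) = commutator (f x) (f y)"
proof -
  interpret group_hom G G f
    using assms is_group by (simp add: group_hom_def group_hom_axioms_def)
  show ?thesis using assms by (simp add: commutator_def)
qed

text \<open>Two subgroups are allowed because conjugation is only known to carry a smaller
  \<open>M W'\<close> into \<open>M W\<close>. The identity map gives monotonicity.\<close>

lemma hom_lower_central:
  assumes f: "f \<in> hom G G" and M: "subgroup M G" "subgroup M' G" and img: "f ` M' \<subseteq> M"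
  shows "f ` lower_central M' k \<subseteq> lower_central M k"
proof (induction k)
  case 0
  then show ?case using img by simp
next
  case (Suc k)
  have MG: "M' \<subseteq> carrier G" "M \<subseteq> carrier G"
    using M subgroup.subset by auto
  have LG: "lower_central M' k \<subseteq> carrier G" "lower_central M k \<subseteq> carrier G"
    using lower_central_subgroup M MG by blast+
  let ?S = "\<lambda>M. {commutator x y |x y. x \<in> lower_central M k \<and> y \<in> M}"
  have "f ` ?S M' \<subseteq> ?S M"
  proof
    fix z assume "z \<in> f ` ?S M'"
    then obtain x y where xy: "x \<in> lower_central M' k" "y \<in> M'" "z = f (commutator x y)" by auto
    then have "x \<in> carrier G" "y \<in> carrier G" using LG(1) MG(1) by blast+
    then have "z = commutator (f x) (f y)"
      using hom_commutator[OF f] xy(3) by simp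
    then show "z \<in> ?S M" using xy Suc img by blast
  qed
  moreover have "?S M \<subseteq> carrier G" "?S M' \<subseteq> carrier G"
    using MG LG by (auto intro!: commutator_closed)
  moreover have "?S M \<subseteq> generate G (?S M)" by (auto intro: generate.incl)
  ultimately show ?case
    unfolding lower_central.simps
    by (intro hom_generate_subset[OF f] generate_is_subgroup) blast+
qed

lemma lower_central_mono:
  assumes "subgroup M G" "subgroup M' G" "M' \<subseteq> M"
  shows "lower_central M' k \<subseteq> lower_central M k"
proof -
  have "(\<lambda>x. x) ` lower_central M' k \<subseteq> lower_central M k"
    by (rule hom_lower_central) (use assms in \<open>auto simp: hom_def\<close>)
  then show ?thesis by simp
qed

lemma inv_cancel:
  assumes "x \<in> carrier G" "y \<in> carrier G"
  shows "inv x \<otimes> (x \<otimes> y) = y" "x \<otimes> (inv x \<otimes> y) = y"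
  using assms by (simp_all flip: m_assoc)

text \<open>The induction rests on \<open>[h1 h2, y] = h1 [h2, y] h1^-1 [h1, y]\<close> and
  \<open>[h^-1, y] = h^-1 [h, y]^-1 h\<close>; the right-hand sides stay in \<open>J\<close> because
  \<open>M\<close> normalises \<open>J\<close>.\<close>

lemma commutator_generate_left:
  assumes M: "subgroup M G" and J: "subgroup J G" "normalizes M J"
    and X: "X \<subseteq> M" and y: "y \<in> M" and comm: "\<And>x. x \<in> X \<Longrightarrow> commutator x y \<in> J"
    and x: "x \<in> generate G X"
  shows "commutator x y \<in> J"
proof -
  have MG: "M \<subseteq> carrier G" and JG: "J \<subseteq> carrier G"
    using M J subgroup.subset by auto
  then have XG: "X \<subseteq> carrier G" and yG: "y \<in> carrier G"
    using X y by auto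
  have gM: "generate G X \<subseteq> M" using X M generate_subgroup_incl by blast
  show ?thesis using x
  proof (induction rule: generate.induct)
    case one
    then show ?case using yG J(1) by (simp add: commutator_def subgroup.one_closed)
  next
    case (incl h)
    then show ?case using comm by blast
  next
    case (inv h)
    have h: "h \<in> carrier G" "inv h \<in> M" using inv XG X subgroup.m_inv_closed[OF M] by auto
    have "conjugate (inv h) (commutator h y) \<in> J"
      using normalizesD[OF J(2)] h comm inv by blast
    then have "inv (conjugate (inv h) (commutator h y)) \<in> J"
      using J(1) subgroup.m_inv_closed by metis
    moreover have "inv (conjugate (inv h) (commutator h y)) = commutator (inv h) y"
    proof -
      have "conjugate (inv h) (commutator h y) = y \<otimes> (inv h \<otimes> (inv y \<otimes> h))"
        using h yG by (simp add: conjugate_def commutator_def m_assoc inv_cancel)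
      then show ?thesis
        using h yG by (simp add: commutator_def inv_mult_group m_assoc)
    qed
    ultimately show ?case by simp
  next
    case (eng h1 h2)
    have h: "h1 \<in> M" "h2 \<in> M" using eng gM by auto
    then have hG: "h1 \<in> carrier G" "h2 \<in> carrier G" using MG by auto
    have "commutator (h1 \<otimes> h2) y = conjugate h1 (commutator h2 y) \<otimes> commutator h1 y"
      using hG yG by (simp add: commutator_def conjugate_def inv_mult_group m_assoc inv_cancel)
    moreover have "conjugate h1 (commutator h2 y) \<in> J"
      using normalizesD[OF J(2)] h eng.IH by blast
    ultimately show ?case using eng.IH J(1) by (simp add: subgroup.m_closed)
  qed
qed

lemma commutator_generate:
  assumes M: "subgroup M G" and J: "subgroup J G" "normalizes M J"
    and XY: "X \<subseteq> M" "Y \<subseteq> M" and comm: "\<And>x y. \<lbrakk>x \<in> X; y \<in> Y\<rbrakk> \<Longrightarrow> commutator x y \<in> J"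
    and xy: "x \<in> generate G X" "y \<in> generate G Y"
  shows "commutator x y \<in> J"
proof -
  have MG: "M \<subseteq> carrier G" using M subgroup.subset by auto
  have gM: "generate G X \<subseteq> M" using XY M generate_subgroup_incl by blast
  have "commutator x y' \<in> J" if "y' \<in> Y" for y'
    using commutator_generate_left[OF M J XY(1) _ _ xy(1)] comm that XY by blast
  then have "commutator y' x \<in> J" if "y' \<in> Y" for y'
    using that commutator_swap[OF J(1)] XY MG xy gM by blast
  then have "commutator y x \<in> J"
    using commutator_generate_left[OF M J XY(2) _ _ xy(2)] xy gM by blast
  then show ?thesis
    using commutator_swap[OF J(1)] xy(1) gM MG generate_subgroup_incl[OF XY(2) M] xy(2) by blast
qed

text \<open>Fitting's theorem: modulo the subgroup generated by the \<open>(k + 1)\<close>-fold intersections,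
  the \<open>k\<close>-fold intersections are central.\<close>

lemma lower_central_product_abelian:
  assumes fin: "finite \<B>" and sub: "\<And>B. B \<in> \<B> \<Longrightarrow> subgroup B G"
    and abelian: "\<And>B x y. \<lbrakk>B \<in> \<B>; x \<in> B; y \<in> B\<rbrakk> \<Longrightarrow> x \<otimes> y = y \<otimes> x"
    and norm: "\<And>B. B \<in> \<B> \<Longrightarrow> normalizes (generate G (\<Union>\<B>)) B"
  shows "lower_central (generate G (\<Union>\<B>)) (card \<B>) = {\<one>}"
proof -
  define M where "M = generate G (\<Union>\<B>)"
  \<comment> \<open>\<open>D k\<close> collects the \<open>k\<close>-fold intersections. The
    condition \<open>S \<noteq> {}\<close> keeps out the empty intersection, which would be the
    whole type.\<close>
  define D where "D k = \<Union> {\<Inter>S |S. S \<subseteq> \<B> \<and> S \<noteq> {} \<and> card S = k}" for k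
  have BG: "\<Union>\<B> \<subseteq> carrier G" using sub subgroup.subset by auto
  have M: "subgroup M G" unfolding M_def by (rule generate_is_subgroup[OF BG])
  have MG: "M \<subseteq> carrier G" using M subgroup.subset by auto
  have BM: "\<Union>\<B> \<subseteq> M" unfolding M_def by (auto intro: generate.incl)
  have DB: "D k \<subseteq> \<Union>\<B>" for k by (auto simp: D_def)
  have norm': "normalizes M B" if "B \<in> \<B>" for B using norm that by (simp add: M_def)
  have "normalizes M (D k)" for k
    unfolding normalizes_def
  proof (intro ballI)
    fix m x assume "m \<in> M" "x \<in> D k"
    then obtain S where S: "S \<subseteq> \<B>" "S \<noteq> {}" "card S = k" "x \<in> \<Inter>S" by (auto simp: D_def)
    then have "conjugate m x \<in> \<Inter>S"
      using \<open>m \<in> M\<close> by (auto intro!: normalizesD[OF norm'])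
    then show "conjugate m x \<in> D k"
      using S(1-3) unfolding D_def by (intro UnionI[of "\<Inter>S"]) auto
  qed
  then have J: "subgroup (generate G (D k)) G" "normalizes M (generate G (D k))" for k
    using order.trans[OF DB BG] MG by (auto intro!: normalizes_generateI generate_is_subgroup)
  have comm: "commutator x y \<in> generate G (D (Suc k))" if xy: "x \<in> D k" "y \<in> \<Union>\<B>" for x y k
  proof -
    obtain S B where S: "S \<subseteq> \<B>" "S \<noteq> {}" "card S = k" "x \<in> \<Inter>S" and B: "B \<in> \<B>" "y \<in> B"
      using xy by (auto simp: D_def)
    have xyM: "x \<in> M" "y \<in> M" using S B BM by auto
    then have xyG: "x \<in> carrier G" "y \<in> carrier G" using MG by auto
    show ?thesis
    proof (cases "B \<in> S")
      case True
      then have "commutator x y = \<one>"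
        using abelian[OF B(1)] B S commutator_eq_one_iff xyG by blast
      then show ?thesis by (simp add: generate.one)
    next
      case False
      \<comment> \<open>If \<open>B\<close> is not in \<open>S\<close>, normality puts the
        commutator of \<open>x\<close> and \<open>y\<close> into every member of \<open>S\<close>
        and also into \<open>B\<close>, a deeper intersection. In the other case \<open>x\<close>
        and \<open>y\<close> lie in the same abelian \<open>B\<close>.\<close>
      have "commutator x y \<in> C" if "C \<in> S" for C
      proof -
        have C: "subgroup C G" "normalizes M C" "x \<in> C" using that S sub norm' by auto
        then have "conjugate y (inv x) \<in> C"
          using normalizesD xyM subgroup.m_inv_closed by metis
        then show ?thesis
          using C xyG by (simp add: commutator_conjugate_right subgroup.m_closed)
      qed
      moreover have "commutator x y \<in> B"
        using normalizesD[OF norm'[OF B(1)] xyM(1) B(2)] sub[OF B(1)] B(2)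
        by (simp add: commutator_conjugate_left subgroup.m_closed subgroup.m_inv_closed)
      moreover have "card (insert B S) = Suc k"
        using False S finite_subset[OF _ fin] by simp
      ultimately have "commutator x y \<in> D (Suc k)"
        using S(1) B(1) unfolding D_def by (intro UnionI[of "\<Inter>(insert B S)"]) blast+
      then show ?thesis by (rule generate.incl)
    qed
  qed
  \<comment> \<open>The shift by one comes from index 0, where \<open>M\<close> is generated by the
    1-fold intersections. At index \<open>card \<B>\<close> there is no subfamily of the required
    size left.\<close>
  have "lower_central M k \<subseteq> generate G (D (Suc k))" for k
  proof (induction k)
    case 0
    have "\<Union>\<B> \<subseteq> D 1"
    proof
      fix x assume "x \<in> \<Union>\<B>"
      then obtain B where "B \<in> \<B>" "x \<in> B" by blast
      then show "x \<in> D 1" unfolding D_def by (intro UnionI[of "\<Inter>{B}"]) auto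
    qed
    then show ?case by (simp add: M_def mono_generate)
  next
    case (Suc k)
    have "commutator x y \<in> generate G (D (Suc (Suc k)))" if "x \<in> lower_central M k" "y \<in> M" for x y
    proof (rule commutator_generate[OF M J order.trans[OF DB BM] BM comm])
      show "x \<in> generate G (D (Suc k))" using that Suc by blast
      show "y \<in> generate G (\<Union>\<B>)" using that by (simp add: M_def)
    qed
    then show ?case
      unfolding lower_central.simps by (intro generate_subgroup_incl[OF _ J(1)]) auto
  qed
  moreover have "D (Suc (card \<B>)) = {}"
  proof -
    have "card S \<noteq> Suc (card \<B>)" if "S \<subseteq> \<B>" for S
      using card_mono[OF fin that] by simp
    then show ?thesis by (auto simp: D_def)
  qed
  ultimately have "lower_central M (card \<B>) \<subseteq> {\<one>}"
    using generate_empty by metis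
  moreover have "\<one> \<in> lower_central M (card \<B>)"
    using lower_central_subgroup[OF M] by (simp add: subgroup.one_closed)
  ultimately show ?thesis unfolding M_def by blast
qed

lemma subgroup_centralizer:
  assumes "x \<in> carrier G"
  shows "subgroup (centralizer G x) G"
proof (rule subgroupI)
  show "a \<otimes> b \<in> centralizer G x" if "a \<in> centralizer G x" "b \<in> centralizer G x" for a b
    using that assms by (simp add: centralizer_def) (metis m_assoc)
  show "inv a \<in> centralizer G x" if "a \<in> centralizer G x" for a
    using that assms commute_inv by (auto simp: centralizer_def)
qed (use assms in \<open>auto simp: centralizer_def\<close>)

end

section \<open>Abelian locally normal subgroups\<close>

context cg_char_simple_tdlc_group
begin

text \<open>For \<open>a\<close> in \<open>A\<close> and \<open>v\<close> in \<open>V\<close> close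
  to the identity, \<open>commutator v a\<close> lies in \<open>A\<close> by normality and in
  \<open>W\<close> by continuity, so it is trivial. Hence \<open>a\<close> has open centraliser, and
  part (i) applies.\<close>

lemma discrete_locally_normal_trivial:
  assumes A: "subgroup A G" and V: "subgroup V G" "openin T V" "normalizes V A"
    and W: "openin T W" "\<one> \<in> W" "A \<inter> W \<subseteq> {\<one>}"
  shows "A = {\<one>}"
proof -
  have AG: "A \<subseteq> carrier G" using A subgroup.subset by auto
  have "a = \<one>" if a: "a \<in> A" for a
  proof -
    have aG: "a \<in> carrier G" using a AG by auto
    define O' where "O' = V \<inter> {v \<in> carrier G. commutator v a \<in> W}"
    have "openin T O'"
      unfolding O'_def
      using V(2) openin_preimage[OF continuous_map_commutator_right[OF aG] W(1)] by blast
    moreover have "\<one> \<in> O'"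
      using aG V W by (simp add: O'_def commutator_def subgroup.one_closed)
    moreover have "O' \<subseteq> centralizer G a"
    proof
      fix v assume v: "v \<in> O'"
      then have "conjugate v a \<in> A" using normalizesD[OF V(3)] a by (auto simp: O'_def)
      then have "commutator v a \<in> A"
        using a A by (simp add: commutator_conjugate_left subgroup.m_closed subgroup.m_inv_closed)
      then have "commutator v a = \<one>" using v W(3) by (auto simp: O'_def)
      then show "v \<in> centralizer G a"
        using commutator_eq_one_iff[OF _ aG] v by (auto simp: O'_def centralizer_def)
    qed
    ultimately have "openin T (centralizer G a)"
      using open_subgroupI[OF subgroup_centralizer[OF aG]] by blast
    then show ?thesis using open_centralizer_trivial aG by blast
  qed
  then show ?thesis using A subgroup.one_closed by blast
qed

section \<open>Normal closures and generation uniform in the open subgroup\<close>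

definition normal_closure :: "'a set \<Rightarrow> 'a set" where
  "normal_closure S = generate G (\<Union>g\<in>carrier G. conjugate g ` S)"

lemma normal_closure:
  assumes "S \<subseteq> carrier G"
  shows "subgroup (normal_closure S) G" "S \<subseteq> normal_closure S"
    "normalizes (carrier G) (normal_closure S)"
proof -
  have sub: "(\<Union>g\<in>carrier G. conjugate g ` S) \<subseteq> carrier G" using assms by auto
  show "subgroup (normal_closure S) G"
    unfolding normal_closure_def by (rule generate_is_subgroup[OF sub])
  show "S \<subseteq> normal_closure S"
  proof
    fix x assume "x \<in> S"
    moreover have "x = conjugate \<one> x" using calculation assms by auto
    ultimately show "x \<in> normal_closure S"
      unfolding normal_closure_def by (intro generate.incl) blast
  qed
  have "normalizes (carrier G) (\<Union>g\<in>carrier G. conjugate g ` S)"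
    unfolding normalizes_def
  proof (intro ballI)
    fix h x assume h: "h \<in> carrier G" and "x \<in> (\<Union>g\<in>carrier G. conjugate g ` S)"
    then obtain g s where "g \<in> carrier G" "s \<in> S" "x = conjugate g s" by blast
    then have "conjugate h x = conjugate (h \<otimes> g) s" "h \<otimes> g \<in> carrier G" "s \<in> S"
      using h assms by (auto simp: conjugate_conjugate)
    then show "conjugate h x \<in> (\<Union>g\<in>carrier G. conjugate g ` S)" by blast
  qed
  then show "normalizes (carrier G) (normal_closure S)"
    unfolding normal_closure_def using sub by (intro normalizes_generateI) auto
qed

lemma normal_closure_mono: "S \<subseteq> S' \<Longrightarrow> normal_closure S \<subseteq> normal_closure S'"
  unfolding normal_closure_def by (intro mono_generate) blast

text \<open>A closed normal subgroup that meets \<open>U\<close> inside the fixator \<open>U1\<close> of the star of the base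
  vertex of a Cayley--Abels graph meets \<open>U\<close> in a normal subgroup of \<open>G\<close>. So the closed normal
  subgroups below all meet the compact set \<open>U - U1\<close>.\<close>

lemma normal_closures_meet:
  assumes A: "subgroup A G" "A \<noteq> {\<one>}" and V: "subgroup V G" "openin T V" "normalizes V A"
  obtains x where "x \<in> carrier G" "x \<noteq> \<one>"
    "\<And>W. \<lbrakk>subgroup W G; openin T W\<rbrakk> \<Longrightarrow> x \<in> T closure_of normal_closure (A \<inter> W)"
proof -
  have AG: "A \<subseteq> carrier G" using A subgroup.subset by auto
  define N where "N W = T closure_of normal_closure (A \<inter> W)" for W
  have N: "subgroup (N W) G" "A \<inter> W \<subseteq> N W" "normalizes (carrier G) (N W)" "closedin T (N W)" for W
  proof -
    have AW: "A \<inter> W \<subseteq> carrier G" using AG by auto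
    show "subgroup (N W) G" unfolding N_def by (intro subgroup_closure_of normal_closure AW)
    show "A \<inter> W \<subseteq> N W"
      using normal_closure(2)[OF AW] closure_of_incl subgroup.subset[OF normal_closure(1)[OF AW]]
      unfolding N_def by blast
    show "normalizes (carrier G) (N W)"
      unfolding N_def by (intro normalizes_closure_of normal_closure AW) auto
  qed (simp add: N_def)
  have "generate G (U \<union> carrier G) = carrier G"
  proof
    show "generate G (U \<union> carrier G) \<subseteq> carrier G"
      using U_subset generate_in_carrier[of "U \<union> carrier G"] by blast
  qed (auto intro: generate.incl)
  then obtain F where F: "finite F" "F \<subseteq> carrier G" "generate G (U \<union> F) = carrier G"
    using finite_generation_over_open[OF compactly_generated subgroup_U open_U, of "carrier G"] by blast
  define F' where "F' = F \<union> m_inv G ` F"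
  have F': "finite F'" "F' \<subseteq> carrier G" using F by (auto simp: F'_def)
  define U1 where "U1 = U \<inter> ((\<Inter>f\<in>F'. {x \<in> carrier G. conjugate f x \<in> U}) \<inter> topspace T)"
  have U1: "openin T U1"
    unfolding U1_def using F' open_U
    by (intro openin_Int openin_INT openin_preimage continuous_map_conjugate) auto
  have one: "\<one> \<in> U1"
    using F' subgroup_U by (auto simp: U1_def topspace_eq subgroup.one_closed subset_iff)
  have "closedin T (U - U1)"
    using closedin_open_subgroup[OF subgroup_U open_U] U1 by blast
  then have compact: "compactin T (U - U1)"
    using closed_compactin[OF compact_U] by blast
  have meet: "(U - U1) \<inter> N W \<noteq> {}" if W: "subgroup W G" "openin T W" for W
  proof
    assume empty: "(U - U1) \<inter> N W = {}"
    have NU: "conjugate f n \<in> N W \<inter> U" if "f \<in> F'" "n \<in> N W \<inter> U" for f n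
    proof -
      have "n \<in> U1" using that empty by blast
      then have "conjugate f n \<in> U" using that by (auto simp: U1_def)
      then show ?thesis using that N(3)[of W] F' by (auto simp: normalizes_def)
    qed
    have "N W \<inter> U = {\<one>}"
    proof (rule normal_in_U_trivial[OF F(3,2)])
      show "subgroup (N W \<inter> U) G" using N(1) subgroup_U subgroups_Inter_pair by blast
      show "normalizes U (N W \<inter> U)"
        using normalizes_Int[OF normalizes_mono[OF N(3)] subgroup_normalizes[OF subgroup_U]]
          U_subset by blast
      show "normalizes F (N W \<inter> U)" "normalizes (m_inv G ` F) (N W \<inter> U)"
        using NU by (auto simp: normalizes_def F'_def)
    qed simp
    \<comment> \<open>\<open>A\<close> now meets an open neighbourhood of the identity trivially,
      which a nontrivial locally normal subgroup cannot do.\<close>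
    then have "A \<inter> (W \<inter> U) \<subseteq> {\<one>}" using N(2)[of W] by blast
    moreover have "openin T (W \<inter> U)" "\<one> \<in> W \<inter> U"
      using W open_U subgroup_U by (auto simp: subgroup.one_closed)
    ultimately show False using discrete_locally_normal_trivial[OF A(1) V] A(2) by blast
  qed
  define \<W> where "\<W> = {W. subgroup W G \<and> openin T W}"
  \<comment> \<open>Finite intersection property: \<open>N\<close> is monotone, so \<open>N\<close>
    of the intersection of finitely many open subgroups lies in each of their images.\<close>
  have "(U - U1) \<inter> \<Inter>\<F> \<noteq> {}" if \<F>: "finite \<F>" "\<F> \<subseteq> N ` \<W>" for \<F>
  proof -
    obtain \<V> where \<V>: "\<V> \<subseteq> \<W>" "finite \<V>" "\<F> = N ` \<V>"
      using finite_subset_image[OF \<F>] by blast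
    define W where "W = carrier G \<inter> (\<Inter>W\<in>\<V>. W)"
    have "subgroup W G \<and> openin T W"
      unfolding W_def using finite_Inter_open_subgroups[OF \<V>(2), of "\<lambda>W. W"] \<V>(1)
      by (auto simp: \<W>_def)
    moreover have "N W \<subseteq> N W'" if "W' \<in> \<V>" for W'
      unfolding N_def by (intro closure_of_mono normal_closure_mono) (use that in \<open>auto simp: W_def\<close>)
    ultimately show ?thesis using meet[of W] \<V>(3) by blast
  qed
  moreover have "\<forall>C\<in>N ` \<W>. closedin T C" using N(4) by blast
  ultimately have "(U - U1) \<inter> \<Inter>(N ` \<W>) \<noteq> {}"
    using compact unfolding compactin_fip by meson
  \<comment> \<open>As \<open>\<one>\<close> lies in \<open>U1\<close>, this common point is not the
    identity.\<close>
  then obtain x where "x \<in> U - U1" "x \<in> \<Inter>(N ` \<W>)" by blast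
  then show ?thesis
    using that[of x] one U_subset by (auto simp: N_def \<W>_def)
qed

text \<open>\<open>\<Phi>\<close> is chosen from the orbit of the common point \<open>x\<close>
  alone, before any \<open>W\<close> is given. For a given \<open>W\<close> the generated subgroup
  contains \<open>U\<close>, so it is open and therefore closed; containing the images of the normal
  closure of \<open>A \<inter> W\<close>, it contains every \<open>f x\<close> with \<open>f\<close>
  in \<open>\<Phi>\<close>.\<close>

lemma uniform_conjugate_generation:
  assumes A: "subgroup A G" "A \<noteq> {\<one>}" and V: "subgroup V G" "openin T V" "normalizes V A"
  obtains \<Phi> where "finite \<Phi>" "\<Phi> \<subseteq> top_aut G T"
    "\<And>W. \<lbrakk>subgroup W G; openin T W\<rbrakk>
      \<Longrightarrow> generate G (U \<union> (\<Union>f\<in>\<Phi>. \<Union>g\<in>carrier G. conjugate g ` f ` (A \<inter> W))) = carrier G"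
proof -
  have AG: "A \<subseteq> carrier G" using A subgroup.subset by auto
  obtain x where x: "x \<in> carrier G" "x \<noteq> \<one>"
    "\<And>W. \<lbrakk>subgroup W G; openin T W\<rbrakk> \<Longrightarrow> x \<in> T closure_of normal_closure (A \<inter> W)"
    using normal_closures_meet[OF A V] by blast
  define D where "D = (\<lambda>f. f x) ` top_aut G T"
  have "D \<subseteq> carrier G" using x(1) top_aut_closed by (auto simp: D_def)
  moreover have "x \<in> D"
  proof -
    have "x = conjugate \<one> x" using x by simp
    then show ?thesis using conjugate_top_aut[OF one_closed] unfolding D_def by blast
  qed
  moreover have "f ` D \<subseteq> D" if "f \<in> top_aut G T" for f
  proof
    fix y assume "y \<in> f ` D"
    then obtain g where "g \<in> top_aut G T" "y = (f \<circ> g) x" by (auto simp: D_def)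
    then show "y \<in> D" using top_aut_comp[OF that] unfolding D_def by blast
  qed
  ultimately obtain F where F: "finite F" "F \<subseteq> D" "generate G (U \<union> F) = carrier G"
    using char_set_generates[of D x] x(2) by blast
  then obtain \<Phi> where \<Phi>: "\<Phi> \<subseteq> top_aut G T" "finite \<Phi>" "F = (\<lambda>f. f x) ` \<Phi>"
    using finite_subset_image[OF F(1) F(2)[unfolded D_def]] by blast
  show ?thesis
  proof (rule that[OF \<Phi>(2,1)])
    fix W assume W: "subgroup W G" "openin T W"
    let ?S = "\<Union>f\<in>\<Phi>. \<Union>g\<in>carrier G. conjugate g ` f ` (A \<inter> W)"
    let ?H = "generate G (U \<union> ?S)"
    have SG: "?S \<subseteq> carrier G"
      using AG \<Phi>(1) top_aut_closed by (auto 4 3)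
    have sub: "subgroup ?H G"
      using SG U_subset by (intro generate_is_subgroup) auto
    have "openin T ?H"
      by (rule open_subgroupI[OF sub open_U])
        (use subgroup_U in \<open>auto intro: generate.incl simp: subgroup.one_closed\<close>)
    then have closed: "closedin T ?H" using closedin_open_subgroup[OF sub] by blast
    have "f x \<in> ?H" if f: "f \<in> \<Phi>" for f
    proof -
      have fa: "f \<in> top_aut G T" using f \<Phi> by blast
      have "f ` (\<Union>g\<in>carrier G. conjugate g ` (A \<inter> W)) \<subseteq> ?H"
      proof
        fix y assume "y \<in> f ` (\<Union>g\<in>carrier G. conjugate g ` (A \<inter> W))"
        then obtain g a where ga: "g \<in> carrier G" "a \<in> A \<inter> W" "y = f (conjugate g a)" by blast
        then have "y = conjugate (f g) (f a)"
          using top_aut_conjugate[OF fa] AG by auto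
        moreover have "f g \<in> carrier G" using top_aut_closed[OF fa] ga by blast
        ultimately have "y \<in> ?S" using f ga(2) by blast
        then show "y \<in> ?H" by (intro generate.incl UnI2)
      qed
      then have "f ` normal_closure (A \<inter> W) \<subseteq> ?H"
        unfolding normal_closure_def
        by (intro hom_generate_subset[OF top_aut_hom[OF fa] _ sub]) (use AG in auto)
      then have "f x \<in> T closure_of ?H"
        by (rule continuous_map_closure_mem[OF top_aut_continuous[OF fa] _ x(3)[OF W]])
      then show ?thesis using closed closure_of_closedin by metis
    qed
    then have "U \<union> F \<subseteq> ?H" using \<Phi>(3) by (auto intro: generate.incl)
    then have "carrier G \<subseteq> ?H" using generate_subgroup_incl[OF _ sub] F(3) by blast
    then show "?H = carrier G" using sub subgroup.subset by blast
  qed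
qed

text \<open>\<open>U\<close> and the members of \<open>\<B>\<close> generate \<open>G\<close>, so
  invariance of \<open>X\<close> need only be checked for them: \<open>U\<close> permutes the
  family, and a member \<open>B\<close> moves the others by commutators that stay in
  \<open>B\<close>. Finitely many elements of \<open>X\<close> centralise a common nontrivial
  \<open>E k W\<close> inside \<open>U\<close>; together with \<open>U\<close> they would make it
  normal in \<open>G\<close>.\<close>

lemma locally_central_normal_set:
  assumes fin: "finite \<B>" and sub: "\<And>B. B \<in> \<B> \<Longrightarrow> subgroup B G"
    and abelian: "\<And>B x y. \<lbrakk>B \<in> \<B>; x \<in> B; y \<in> B\<rbrakk> \<Longrightarrow> x \<otimes> y = y \<otimes> x"
    and norm: "\<And>B. B \<in> \<B> \<Longrightarrow> \<exists>V. subgroup V G \<and> openin T V \<and> normalizes V B"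
    and inv: "\<And>u B. \<lbrakk>u \<in> U; B \<in> \<B>\<rbrakk> \<Longrightarrow> conjugate u ` B \<in> \<B>"
    and gen: "generate G (U \<union> \<Union>\<B>) = carrier G"
    and nontrivial: "B0 \<in> \<B>" "B0 \<noteq> {\<one>}"
  obtains X W where "X \<subseteq> carrier G" "normalizes (carrier G) X" "subgroup W G" "openin T W"
    "\<And>B. B \<in> \<B> \<Longrightarrow> B \<inter> W \<subseteq> X"
    "\<And>F. \<lbrakk>finite F; F \<subseteq> X\<rbrakk> \<Longrightarrow> generate G (U \<union> F) \<noteq> carrier G"
proof -
  have BG: "B \<subseteq> carrier G" if "B \<in> \<B>" for B using sub[OF that] subgroup.subset by auto
  obtain N where N: "\<And>B. B \<in> \<B> \<Longrightarrow> subgroup (N B) G \<and> openin T (N B) \<and> normalizes (N B) B"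
    using norm by metis
  define V where "V = carrier G \<inter> (\<Inter>B\<in>\<B>. N B)"
  have V: "subgroup V G" "openin T V"
    using finite_Inter_open_subgroups[OF fin, of N] N unfolding V_def by blast+
  have VN: "normalizes V B" if "B \<in> \<B>" for B
    using N[OF that] that by (auto simp: V_def normalizes_def)
  \<comment> \<open>Lying in \<open>V\<close> lets \<open>W\<close> normalise every member of
    \<open>\<B>\<close>, lying in \<open>U\<close> bounds all the terms \<open>E k W\<close> by a
    compact set, and normality in \<open>U\<close> lets \<open>U\<close> act on
    \<open>M W\<close>.\<close>
  define adm where
    "adm W \<longleftrightarrow> subgroup W G \<and> openin T W \<and> W \<subseteq> V \<and> W \<subseteq> U \<and> normalizes U W" for W
  have adm_ex: "\<exists>W. adm W \<and> W \<subseteq> O'" if "openin T O'" "\<one> \<in> O'" for O'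
  proof -
    have "openin T (O' \<inter> V)" "\<one> \<in> O' \<inter> V" using that V by (auto simp: subgroup.one_closed)
    then show ?thesis using open_normal_in_U[of "O' \<inter> V"] unfolding adm_def by (metis Int_subset_iff)
  qed
  have adm_Int: "adm (W \<inter> W')" if "adm W" "adm W'" for W W'
    using that subgroups_Inter_pair normalizes_Int unfolding adm_def by blast
  define M where "M W = generate G (\<Union>B\<in>\<B>. B \<inter> W)" for W
  have SG: "(\<Union>B\<in>\<B>. B \<inter> W) \<subseteq> carrier G" for W using BG by auto
  have M: "subgroup (M W) G" for W unfolding M_def by (rule generate_is_subgroup[OF SG])
  have MW: "M W \<subseteq> W" if "subgroup W G" for W
    unfolding M_def by (rule generate_subgroup_incl[OF _ that]) auto
  have M_incl: "B \<inter> W \<subseteq> M W" if "B \<in> \<B>" for B W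
    unfolding M_def using that by (auto intro: generate.incl)
  have M_mono: "M W' \<subseteq> M W" if "W' \<subseteq> W" for W W'
    unfolding M_def by (rule mono_generate) (use that in auto)
  define E where "E k W = lower_central (M W) k" for k W
  have E: "subgroup (E k W) G" "E k W \<subseteq> M W" for k W
    using lower_central_subgroup[OF M] by (auto simp: E_def)
  have EG: "E k W \<subseteq> carrier G" for k W using E subgroup.subset by blast
  have E_mono: "E k W' \<subseteq> E k W" if "W' \<subseteq> W" for k W W'
    unfolding E_def by (rule lower_central_mono[OF M M M_mono[OF that]])
  have E_conj: "conjugate g ` E k W' \<subseteq> E k W" if "g \<in> carrier G" "conjugate g ` M W' \<subseteq> M W" for g k W W'
    unfolding E_def by (rule hom_lower_central[OF conjugate_hom[OF that(1)] M M that(2)])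
  have M_conj: "conjugate g ` M W' \<subseteq> M W"
    if "g \<in> carrier G" "\<And>B b. \<lbrakk>B \<in> \<B>; b \<in> B; b \<in> W'\<rbrakk> \<Longrightarrow> conjugate g b \<in> M W" for g W W'
    unfolding M_def[of W']
    by (rule hom_generate_subset[OF conjugate_hom[OF that(1)] SG M]) (use that in auto)
  have U_conj: "conjugate u ` M W \<subseteq> M W" if "adm W" "u \<in> U" for u W
  proof (rule M_conj)
    fix B b assume "B \<in> \<B>" "b \<in> B" "b \<in> W"
    then have "conjugate u b \<in> conjugate u ` B" "conjugate u b \<in> W"
      using that by (auto simp: adm_def normalizes_def)
    then show "conjugate u b \<in> M W" using M_incl[OF inv[OF that(2) \<open>B \<in> \<B>\<close>]] by blast
  qed (use that U_subset in auto)
  \<comment> \<open>\<open>conjugate a c\<close> equals \<open>commutator a c \<otimes> c\<close>.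
    The choice of \<open>W'\<close>, which depends on \<open>a\<close>, puts the commutator into
    \<open>W\<close>, so it lies in \<open>B \<inter> W\<close> and hence in
    \<open>M W\<close>.\<close>
  have commensurate: "\<exists>W'. adm W' \<and> conjugate a ` M W' \<subseteq> M W" if "adm W" "B \<in> \<B>" "a \<in> B" for a B W
  proof -
    have W: "subgroup W G" "openin T W" using that by (auto simp: adm_def)
    have a: "a \<in> carrier G" using that BG by blast
    let ?O = "W \<inter> {c \<in> carrier G. commutator a c \<in> W}"
    have "openin T ?O"
      using W openin_preimage[OF continuous_map_commutator_left[OF a]] by blast
    moreover have "\<one> \<in> ?O" using W a by (simp add: commutator_def subgroup.one_closed)
    ultimately obtain W' where W': "adm W'" "W' \<subseteq> ?O" using adm_ex by blast
    have "conjugate a ` M W' \<subseteq> M W"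
    proof (rule M_conj[OF a])
      fix C c assume c: "C \<in> \<B>" "c \<in> C" "c \<in> W'"
      have cG: "c \<in> carrier G" using c BG by blast
      have "conjugate c (inv a) \<in> B"
        using normalizesD[OF VN[OF \<open>B \<in> \<B>\<close>]] c W' that sub[OF \<open>B \<in> \<B>\<close>]
        by (auto simp: adm_def subgroup.m_inv_closed)
      then have "commutator a c \<in> B"
        using sub[OF \<open>B \<in> \<B>\<close>] \<open>a \<in> B\<close> a cG
        by (simp add: commutator_conjugate_right subgroup.m_closed)
      then have "commutator a c \<in> M W"
        using M_incl[OF \<open>B \<in> \<B>\<close>] c W' by blast
      moreover have "c \<in> M W" using M_incl[OF c(1)] c W' by blast
      moreover have "conjugate a c = commutator a c \<otimes> c"
        using a cG by (simp add: commutator_conjugate_left m_assoc)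
      ultimately show "conjugate a c \<in> M W" using M by (simp add: subgroup.m_closed)
    qed
    then show ?thesis using W' by blast
  qed
  obtain W1 where W1: "adm W1" using adm_ex[OF V(2)] V(1) subgroup.one_closed by blast
  have E0: "E 0 W \<noteq> {\<one>}" if "adm W" for W
  proof
    assume "E 0 W = {\<one>}"
    then have "B0 \<inter> W \<subseteq> {\<one>}" using M_incl[OF nontrivial(1), of W] by (simp add: E_def)
    then show False
      using discrete_locally_normal_trivial[OF sub[OF nontrivial(1)] V VN[OF nontrivial(1)], of W]
        that nontrivial(2) by (auto simp: adm_def subgroup.one_closed)
  qed
  have "\<exists>n. E n W1 = {\<one>}"
  proof -
    let ?\<C> = "(\<lambda>B. B \<inter> W1) ` \<B>"
    have W1': "subgroup W1 G" "W1 \<subseteq> V" using W1 by (auto simp: adm_def)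
    have eq: "generate G (\<Union>?\<C>) = M W1" by (simp add: M_def)
    have "lower_central (generate G (\<Union>?\<C>)) (card ?\<C>) = {\<one>}"
    proof (rule lower_central_product_abelian)
      fix C assume "C \<in> ?\<C>"
      then obtain B where B: "B \<in> \<B>" "C = B \<inter> W1" by blast
      show "subgroup C G" using sub[OF B(1)] W1'(1) B(2) subgroups_Inter_pair by blast
      show "x \<otimes> y = y \<otimes> x" if "x \<in> C" "y \<in> C" for x y
        using abelian[OF B(1)] that B(2) by blast
      show "normalizes (generate G (\<Union>?\<C>)) C"
        unfolding eq B(2)
        using MW[OF W1'(1)] W1' VN[OF B(1)] subgroup_normalizes[OF W1'(1)]
        by (intro normalizes_Int) (meson normalizes_mono order.trans)+
    qed (use fin in simp)
    then show ?thesis unfolding eq E_def by blast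
  qed
  then have "\<not> (\<forall>n. \<forall>W. adm W \<longrightarrow> E n W \<noteq> {\<one>})" using W1 by blast
  \<comment> \<open>Nontriviality for all admissible \<open>W\<close> holds at index 0 and fails at
    some \<open>n\<close>, so the inductive step fails at some \<open>k\<close>. One
    \<open>W0\<close> kills the next term, while the \<open>k\<close>-th term survives however small
    \<open>W\<close> is.\<close>
  then obtain k where k: "\<And>W. adm W \<Longrightarrow> E k W \<noteq> {\<one>}" "\<exists>W. adm W \<and> E (Suc k) W = {\<one>}"
    using E0 nat_induct[of "\<lambda>n. \<forall>W. adm W \<longrightarrow> E n W \<noteq> {\<one>}"] by blast
  then obtain W0 where W0: "adm W0" "E (Suc k) W0 = {\<one>}" by blast
  define X where "X = {x \<in> carrier G. \<exists>W. adm W \<and> (\<forall>e\<in>E k W. x \<otimes> e = e \<otimes> x)}"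
  have XG: "X \<subseteq> carrier G" by (auto simp: X_def)
  \<comment> \<open>If \<open>x\<close> centralises \<open>E k W\<close>, then
    \<open>conjugate g x\<close> centralises every \<open>e\<close> with
    \<open>conjugate (inv g) e\<close> in \<open>E k W\<close>; hence the hypothesis on
    \<open>inv g\<close>.\<close>
  have X_conj: "conjugate g x \<in> X"
    if g: "g \<in> carrier G" "\<And>W. adm W \<Longrightarrow> \<exists>W'. adm W' \<and> conjugate (inv g) ` M W' \<subseteq> M W"
      and x: "x \<in> X" for g x
  proof -
    obtain W where W: "adm W" "\<forall>e\<in>E k W. x \<otimes> e = e \<otimes> x" "x \<in> carrier G"
      using x by (auto simp: X_def)
    obtain W' where W': "adm W'" "conjugate (inv g) ` M W' \<subseteq> M W" using g(2)[OF W(1)] by blast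
    have "conjugate g x \<otimes> e = e \<otimes> conjugate g x" if e: "e \<in> E k W'" for e
    proof -
      have eG: "e \<in> carrier G" using e EG by blast
      have "conjugate (inv g) e \<in> E k W" using E_conj[OF _ W'(2)] g e by blast
      then have "x \<otimes> conjugate (inv g) e = conjugate (inv g) e \<otimes> x" using W by blast
      then have "conjugate g (x \<otimes> conjugate (inv g) e) = conjugate g (conjugate (inv g) e \<otimes> x)"
        by simp
      then show ?thesis using g(1) W(3) eG by (simp add: conjugate_mult)
    qed
    then show ?thesis using W' g(1) W(3) by (auto simp: X_def)
  qed
  have U_inv: "inv u \<in> U" if "u \<in> U" for u using subgroup.m_inv_closed[OF subgroup_U that] .
  have XU: "conjugate u x \<in> X" if "u \<in> U" "x \<in> X" for u x
    using that(1) U_subset U_conj[OF _ U_inv[OF that(1)]] by (intro X_conj[OF _ _ that(2)]) blast+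
  have XB: "conjugate a x \<in> X" if "B \<in> \<B>" "a \<in> B" "x \<in> X" for a B x
    using that(1,2) BG commensurate[OF _ that(1)] subgroup.m_inv_closed[OF sub[OF that(1)] that(2)]
    by (intro X_conj[OF _ _ that(3)]) blast+
  have XN: "normalizes (carrier G) X"
  proof -
    have "normalizes (generate G (U \<union> \<Union>\<B>)) X"
    proof (rule generate_normalizes)
      show "normalizes (m_inv G ` (U \<union> \<Union>\<B>)) X"
        using XU[OF U_inv] XB sub by (auto simp: normalizes_def subgroup.m_inv_closed)
      show "U \<union> \<Union>\<B> \<subseteq> carrier G" using U_subset BG by blast
    qed (use XU XB XG in \<open>auto simp: normalizes_def\<close>)
    then show ?thesis using gen by simp
  qed
  \<comment> \<open>The vanishing of the next term means that all of \<open>M W0\<close> centralises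
    \<open>E k W0\<close>.\<close>
  have BX: "B \<inter> W0 \<subseteq> X" if "B \<in> \<B>" for B
  proof
    fix b assume b: "b \<in> B \<inter> W0"
    then have bM: "b \<in> M W0" using M_incl[OF that] by blast
    have bG: "b \<in> carrier G" using b BG[OF that] by blast
    have "b \<otimes> e = e \<otimes> b" if e: "e \<in> E k W0" for e
    proof -
      have "commutator e b \<in> E (Suc k) W0"
        unfolding E_def lower_central.simps
        using e bM by (intro generate.incl) (auto simp: E_def)
      then have "commutator e b = \<one>" using W0(2) by blast
      then show ?thesis using commutator_eq_one_iff[of e b] e EG bG by (metis subsetD)
    qed
    then show "b \<in> X" using W0(1) bG by (auto simp: X_def)
  qed
  have XF: "generate G (U \<union> F) \<noteq> carrier G" if F: "finite F" "F \<subseteq> X" for F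
  proof
    assume genF: "generate G (U \<union> F) = carrier G"
    have "\<exists>W. adm W \<and> (\<forall>f\<in>F. \<forall>e\<in>E k W. f \<otimes> e = e \<otimes> f)"
      using F
    proof (induction rule: finite_induct)
      case empty
      then show ?case using W0 by blast
    next
      case (insert f F)
      then obtain W W' where "adm W" "\<forall>f\<in>F. \<forall>e\<in>E k W. f \<otimes> e = e \<otimes> f"
        "adm W'" "\<forall>e\<in>E k W'. f \<otimes> e = e \<otimes> f" by (auto simp: X_def)
      moreover have "E k (W \<inter> W') \<subseteq> E k W" "E k (W \<inter> W') \<subseteq> E k W'"
        by (auto intro!: E_mono)
      ultimately show ?case using adm_Int by (intro exI[of _ "W \<inter> W'"]) blast
    qed
    then obtain W where W: "adm W" "\<And>f e. \<lbrakk>f \<in> F; e \<in> E k W\<rbrakk> \<Longrightarrow> f \<otimes> e = e \<otimes> f" by blast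
    have "E k W = {\<one>}"
    proof (rule centralized_in_U_trivial[OF genF])
      show "F \<subseteq> carrier G" using F XG by blast
      show "E k W \<subseteq> U" using E(2) MW W(1) unfolding adm_def by blast
      show "normalizes U (E k W)"
        unfolding normalizes_def
        using E_conj[OF _ U_conj[OF W(1)]] U_subset by blast
    qed (use E W(2) in auto)
    then show False using k(1)[OF W(1)] by blast
  qed
  show ?thesis
    by (rule that[OF XG XN _ _ BX XF]) (use W0 in \<open>auto simp: adm_def\<close>)
qed

text \<open>The conjugate of \<open>B\<close> by \<open>u\<close> depends only on the coset
  \<open>u V\<close>, and finitely many such cosets cover the compact \<open>U\<close>.\<close>

lemma finite_conjugates:
  assumes B: "subgroup B G" and V: "subgroup V G" "openin T V" "normalizes V B"
  shows "finite ((\<lambda>u. conjugate u ` B) ` U)"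
proof -
  have BG: "B \<subseteq> carrier G" and VG: "V \<subseteq> carrier G" using B V subgroup.subset by auto
  define c where "c f = {y \<in> carrier G. inv f \<otimes> y \<in> V}" for f
  have "openin T (c f)" if "f \<in> U" for f
    unfolding c_def by (intro openin_preimage group_continuous_intros V) (use that U_subset in auto)
  then have opn: "\<forall>W\<in>c ` U. openin T W" by blast
  have "U \<subseteq> \<Union> (c ` U)"
  proof
    fix u assume "u \<in> U"
    then have "u \<in> c u" using U_subset V(1) by (auto simp: c_def subgroup.one_closed)
    then show "u \<in> \<Union> (c ` U)" using \<open>u \<in> U\<close> by blast
  qed
  then obtain \<F> where \<F>: "finite \<F>" "\<F> \<subseteq> c ` U" "U \<subseteq> \<Union>\<F>"
    using compact_U opn unfolding compactin_def by meson
  then obtain F where F: "finite F" "F \<subseteq> U" "\<F> = c ` F"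
    using finite_subset_image[OF \<F>(1,2)] by blast
  have "(\<lambda>u. conjugate u ` B) ` U \<subseteq> (\<lambda>u. conjugate u ` B) ` F"
  proof
    fix C assume "C \<in> (\<lambda>u. conjugate u ` B) ` U"
    then obtain u where u: "u \<in> U" "C = conjugate u ` B" by blast
    then obtain f where f: "f \<in> F" "inv f \<otimes> u \<in> V"
      using \<F>(3) F(3) by (auto simp: c_def)
    define v where "v = inv f \<otimes> u"
    have G: "u \<in> carrier G" "f \<in> carrier G" "v \<in> carrier G" using u f F U_subset by (auto simp: v_def)
    have uv: "u = f \<otimes> v" using G by (simp add: v_def m_assoc[symmetric])
    have v: "v \<in> V" "inv v \<in> V" using f V(1) by (auto simp: v_def subgroup.m_inv_closed)
    have "conjugate v ` B = B"
    proof
      show "conjugate v ` B \<subseteq> B" using V(3) v by (auto simp: normalizes_def)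
      show "B \<subseteq> conjugate v ` B"
      proof
        fix b assume "b \<in> B"
        then have "b = conjugate v (conjugate (inv v) b)" "conjugate (inv v) b \<in> B"
          using V(3) v BG G by (auto simp: normalizes_def)
        then show "b \<in> conjugate v ` B" by blast
      qed
    qed
    moreover have "conjugate u ` B = conjugate f ` conjugate v ` B"
      unfolding image_image uv using G BG by (intro image_cong) (auto simp: conjugate_conjugate)
    ultimately show "C \<in> (\<lambda>u. conjugate u ` B) ` F" using u f by auto
  qed
  then show ?thesis by (rule finite_surj[OF F(1)])
qed

text \<open>An open subgroup that normalises \<open>B\<close> replaces the open normaliser, since
  such a witness is easily transported by automorphisms.\<close>

definition abelian_locally_normal :: "'a set \<Rightarrow> bool" where
  "abelian_locally_normal B \<longleftrightarrow> subgroup B G \<and> (\<forall>x\<in>B. \<forall>y\<in>B. x \<otimes> y = y \<otimes> x) \<and>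
     (\<exists>V. subgroup V G \<and> openin T V \<and> normalizes V B)"

lemma abelian_locally_normal_subset: "abelian_locally_normal B \<Longrightarrow> B \<subseteq> carrier G"
  unfolding abelian_locally_normal_def using subgroup.subset by blast

lemma abelian_locally_normal_image:
  assumes f: "f \<in> top_aut G T" and B: "abelian_locally_normal B"
  shows "abelian_locally_normal (f ` B)"
proof -
  obtain V where V: "subgroup V G" "openin T V" "normalizes V B"
    using B by (auto simp: abelian_locally_normal_def)
  have sub: "B \<subseteq> carrier G" "V \<subseteq> carrier G"
    using B V subgroup.subset by (auto simp: abelian_locally_normal_def)
  have "f x \<otimes> f y = f y \<otimes> f x" if "x \<in> B" "y \<in> B" for x y
    using that B sub top_aut_mult[OF f, of x y] top_aut_mult[OF f, of y x]
    by (auto simp: abelian_locally_normal_def subset_iff)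
  moreover have "normalizes (f ` V) (f ` B)"
  proof -
    have "conjugate (f v) (f b) = f (conjugate v b)" if "v \<in> V" "b \<in> B" for v b
    proof -
      have "v \<in> carrier G" "b \<in> carrier G" using that sub by blast+
      then show ?thesis by (simp add: top_aut_conjugate[OF f])
    qed
    then show ?thesis using V(3) by (auto simp: normalizes_def)
  qed
  moreover have "subgroup (f ` B) G" "subgroup (f ` V) G" "openin T (f ` V)"
    using B V top_aut_subgroup[OF f] top_aut_openin[OF f]
    by (simp_all add: abelian_locally_normal_def)
  ultimately show ?thesis
    unfolding abelian_locally_normal_def by blast
qed

theorem abelian_locally_normal_trivial:
  assumes A: "abelian_locally_normal A"
  shows "A = {\<one>}"
proof (rule ccontr)
  assume nontrivial: "A \<noteq> {\<one>}"
  obtain V where V: "subgroup V G" "openin T V" "normalizes V A"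
    using A by (auto simp: abelian_locally_normal_def)
  have subA: "subgroup A G" using A by (simp add: abelian_locally_normal_def)
  then have AG: "A \<subseteq> carrier G" using subgroup.subset by auto
  obtain \<Phi> where \<Phi>: "finite \<Phi>" "\<Phi> \<subseteq> top_aut G T"
    "\<And>W. \<lbrakk>subgroup W G; openin T W\<rbrakk>
      \<Longrightarrow> generate G (U \<union> (\<Union>f\<in>\<Phi>. \<Union>g\<in>carrier G. conjugate g ` f ` (A \<inter> W))) = carrier G"
    using uniform_conjugate_generation[OF subA nontrivial V] by blast
  define D where "D W = (\<Union>f\<in>\<Phi>. \<Union>g\<in>carrier G. conjugate g ` f ` (A \<inter> W))" for W
  have DG: "D W \<subseteq> carrier G" for W
    using AG \<Phi>(2) top_aut_closed by (auto 4 3 simp: D_def)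
  have finD: "\<exists>F. finite F \<and> F \<subseteq> D W \<and> generate G (U \<union> F) = carrier G"
    if "subgroup W G" "openin T W" for W
    using finite_generation_over_open[OF compactly_generated subgroup_U open_U DG] \<Phi>(3)[OF that]
    unfolding D_def by metis
  obtain F where F: "finite F" "F \<subseteq> D (carrier G)" "generate G (U \<union> F) = carrier G"
    using finD[OF subgroup_self openin_carrier] by blast
  have "\<exists>h. h \<in> top_aut G T \<and> x \<in> h ` A" if "x \<in> F" for x
  proof -
    obtain f g a where "f \<in> \<Phi>" "g \<in> carrier G" "a \<in> A" "x = conjugate g (f a)"
      using subsetD[OF F(2) \<open>x \<in> F\<close>] by (auto simp: D_def)
    then have "conjugate g \<circ> f \<in> top_aut G T" "x = (conjugate g \<circ> f) a" "a \<in> A"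
      using top_aut_comp[OF conjugate_top_aut] \<Phi>(2) by auto
    then show ?thesis by blast
  qed
  then obtain h where h: "\<And>x. x \<in> F \<Longrightarrow> h x \<in> top_aut G T \<and> x \<in> h x ` A" by metis
  \<comment> \<open>\<open>A\<close> supplies a nontrivial member, the images under the
    automorphisms \<open>h x\<close> contain \<open>F\<close> and so generate \<open>G\<close> with
    \<open>U\<close>, and the images under \<open>\<Phi>\<close> are there for the small pieces of
    \<open>A\<close> that end up in \<open>X\<close>.\<close>
  define \<B>1 where "\<B>1 = insert A ((\<lambda>f. f ` A) ` (\<Phi> \<union> h ` F))"
  have fin1: "finite \<B>1" using \<Phi>(1) F(1) by (simp add: \<B>1_def)
  have good1: "abelian_locally_normal B" if "B \<in> \<B>1" for B
    using that A abelian_locally_normal_image h \<Phi>(2) by (auto simp: \<B>1_def)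
  define \<B> where "\<B> = (\<Union>B\<in>\<B>1. (\<lambda>u. conjugate u ` B) ` U)"
  have one_U: "\<one> \<in> U" using subgroup_U subgroup.one_closed by blast
  have \<B>1: "\<B>1 \<subseteq> \<B>"
  proof
    fix B assume B: "B \<in> \<B>1"
    then have "B \<subseteq> carrier G" using good1 abelian_locally_normal_subset by blast
    then have "conjugate \<one> ` B = (\<lambda>x. x) ` B" by (intro image_cong) auto
    then have "B = conjugate \<one> ` B" by simp
    then show "B \<in> \<B>" unfolding \<B>_def using B one_U by blast
  qed
  have good: "abelian_locally_normal B" if "B \<in> \<B>" for B
    using that good1 abelian_locally_normal_image conjugate_top_aut U_subset
    by (auto simp: \<B>_def)
  have fin: "finite \<B>"
    unfolding \<B>_def using fin1
  proof (rule finite_UN_I)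
    show "finite ((\<lambda>u. conjugate u ` B) ` U)" if "B \<in> \<B>1" for B
      using good1[OF that] finite_conjugates unfolding abelian_locally_normal_def by blast
  qed
  have inv: "conjugate u ` B \<in> \<B>" if u: "u \<in> U" "B \<in> \<B>" for u B
  proof -
    obtain C w where C: "C \<in> \<B>1" "w \<in> U" "B = conjugate w ` C" using u by (auto simp: \<B>_def)
    then have "C \<subseteq> carrier G" using good1 abelian_locally_normal_subset by blast
    moreover have "u \<in> carrier G" "w \<in> carrier G" using C u U_subset by auto
    ultimately have "conjugate u ` B = conjugate (u \<otimes> w) ` C"
      unfolding C(3) image_image by (intro image_cong) (auto simp: conjugate_conjugate)
    moreover have "u \<otimes> w \<in> U" using C u subgroup_U subgroup.m_closed by metis
    ultimately show ?thesis using C(1) unfolding \<B>_def by blast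
  qed
  have BG: "\<Union>\<B> \<subseteq> carrier G"
    using good abelian_locally_normal_subset by blast
  have "F \<subseteq> \<Union>\<B>"
  proof
    fix x assume "x \<in> F"
    then have "h x ` A \<in> \<B>1" "x \<in> h x ` A" using h by (auto simp: \<B>1_def)
    then show "x \<in> \<Union>\<B>" using \<B>1 by blast
  qed
  then have "carrier G \<subseteq> generate G (U \<union> \<Union>\<B>)"
    using mono_generate[of "U \<union> F" "U \<union> \<Union>\<B>"] F(3) by blast
  moreover have "generate G (U \<union> \<Union>\<B>) \<subseteq> carrier G"
    using generate_in_carrier[of "U \<union> \<Union>\<B>"] BG U_subset by blast
  ultimately have gen: "generate G (U \<union> \<Union>\<B>) = carrier G" by blast
  obtain X W where X: "X \<subseteq> carrier G" "normalizes (carrier G) X" "subgroup W G" "openin T W"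
    "\<And>B. B \<in> \<B> \<Longrightarrow> B \<inter> W \<subseteq> X"
    "\<And>F. \<lbrakk>finite F; F \<subseteq> X\<rbrakk> \<Longrightarrow> generate G (U \<union> F) \<noteq> carrier G"
  proof (rule locally_central_normal_set[OF fin _ _ _ inv gen _ nontrivial])
    show "A \<in> \<B>" using \<B>1 by (auto simp: \<B>1_def)
  qed (use good in \<open>auto simp: abelian_locally_normal_def\<close>)
  \<comment> \<open>\<open>W\<close> is pulled back along \<open>\<Phi>\<close>, so that each
    \<open>f\<close> in \<open>\<Phi>\<close> maps \<open>A \<inter> W'\<close> into
    \<open>W\<close>, hence into \<open>X\<close>. By uniformity the conjugates of these images
    still generate \<open>G\<close> with \<open>U\<close>.\<close>
  define W' where "W' = carrier G \<inter> (\<Inter>f\<in>\<Phi>. {x \<in> carrier G. f x \<in> W})"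
  have W': "subgroup W' G \<and> openin T W'"
    unfolding W'_def
  proof (rule finite_Inter_open_subgroups[OF \<Phi>(1)])
    fix f assume "f \<in> \<Phi>"
    then have f: "f \<in> top_aut G T" using \<Phi>(2) by blast
    have "subgroup {x \<in> carrier G. f x \<in> W} G"
      by (rule subgroupI)
        (use X(3) in \<open>auto simp: top_aut_inv[OF f] top_aut_mult[OF f] subgroup.m_closed
          subgroup.m_inv_closed top_aut_one[OF f] subgroup.one_closed intro!: exI[of _ \<one>]\<close>)
    moreover have "openin T {x \<in> carrier G. f x \<in> W}"
      by (rule openin_preimage[OF top_aut_continuous[OF f] X(4)])
    ultimately show "subgroup {x \<in> carrier G. f x \<in> W} G \<and> openin T {x \<in> carrier G. f x \<in> W}"
      by blast
  qed
  have "D W' \<subseteq> X"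
  proof
    fix x assume "x \<in> D W'"
    then obtain f g a where a: "f \<in> \<Phi>" "g \<in> carrier G" "a \<in> A" "a \<in> W'" "x = conjugate g (f a)"
      by (auto simp: D_def)
    then have "f ` A \<in> \<B>" using \<B>1 by (auto simp: \<B>1_def)
    moreover have "f a \<in> f ` A \<inter> W" using a by (auto simp: W'_def)
    ultimately have "f a \<in> X" using X(5) by blast
    then show "x \<in> X" using normalizesD[OF X(2)] a by blast
  qed
  then show False using finD[of W'] W' X(6) by (meson order.trans)
qed

section \<open>From abelian to virtually soluble locally normal subgroups\<close>

lemma exp_of_derived_closure_of:
  assumes "S \<subseteq> carrier G"
  shows "(derived G ^^ n) (T closure_of S) \<subseteq> T closure_of (derived G ^^ n) S"
proof (induction n)
  case (Suc n)
  let ?D = "(derived G ^^ n) S"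
  have DG: "?D \<subseteq> carrier G" using exp_of_derived_in_carrier[OF assms] .
  have "derived G (T closure_of ?D) \<subseteq> T closure_of (derived G ?D)"
    unfolding derived_def[of G "T closure_of ?D"]
  proof (rule generate_subgroup_incl)
    show "subgroup (T closure_of derived G ?D) G"
      by (rule subgroup_closure_of[OF derived_is_subgroup[OF DG]])
    \<comment> \<open>The commutator is continuous in each variable, so commutators of points in the
      closure lie in the closure of the derived subgroup.\<close>
    have "commutator x y \<in> T closure_of derived G ?D"
      if "x \<in> T closure_of ?D" "y \<in> T closure_of ?D" for x y
      by (rule continuous_map2_closure_mem[OF continuous_map_commutator_left
            continuous_map_commutator_right DG DG _ that])
        (auto simp: derived_def commutator_def intro: generate.incl)
    then show "derived_set G (T closure_of ?D) \<subseteq> T closure_of derived G ?D"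
      by (auto simp: commutator_def)
  qed
  then show ?case
    using mono_derived[OF Suc] by auto
qed simp

text \<open>The last nontrivial term of the derived series is abelian. Conjugation by an element of
  \<open>V\<close> maps \<open>S\<close>, and with it each derived term, into itself.\<close>

lemma solvable_locally_normal_trivial:
  assumes S: "subgroup S G" "(derived G ^^ n) S \<subseteq> {\<one>}"
    and V: "subgroup V G" "openin T V" "normalizes V S"
  shows "S = {\<one>}"
proof (rule ccontr)
  assume S1: "S \<noteq> {\<one>}"
  have SG: "S \<subseteq> carrier G" and VG: "V \<subseteq> carrier G" using S V subgroup.subset by auto
  define D where "D k = (derived G ^^ k) S" for k
  have D: "subgroup (D k) G" for k unfolding D_def by (rule exp_of_derived_is_subgroup[OF S(1)])
  have DG: "D k \<subseteq> carrier G" for k using D subgroup.subset by blast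
  have Dn: "D n = {\<one>}"
    using D[of n] S(2) by (auto simp: D_def dest: subgroup.one_closed)
  moreover have "D 0 \<noteq> {\<one>}" using S1 by (simp add: D_def)
  ultimately obtain k where k: "D k \<noteq> {\<one>}" "D (Suc k) = {\<one>}"
    using nat_induct[of "\<lambda>n. D n \<noteq> {\<one>}"] by blast
  have "x \<otimes> y = y \<otimes> x" if xy: "x \<in> D k" "y \<in> D k" for x y
  proof -
    have "commutator x y \<in> derived G (D k)"
      unfolding derived_def commutator_def using xy by (intro generate.incl) blast
    then have "commutator x y = \<one>" using k(2) by (simp add: D_def)
    then show ?thesis using commutator_eq_one_iff xy DG by (metis subsetD)
  qed
  moreover have "normalizes V (D k)"
    unfolding normalizes_def
  proof (intro ballI)
    fix v d assume v: "v \<in> V" and d: "d \<in> D k"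
    interpret group_hom G G "conjugate v"
      using conjugate_hom v VG is_group by (auto simp: group_hom_def group_hom_axioms_def)
    have "conjugate v ` D k = (derived G ^^ k) (conjugate v ` S)"
      unfolding D_def using exp_of_derived_img[OF SG] by simp
    also have "\<dots> \<subseteq> D k"
      unfolding D_def using V(3) v by (intro mono_exp_of_derived) (auto simp: normalizes_def)
    finally show "conjugate v d \<in> D k" using d by blast
  qed
  ultimately have "abelian_locally_normal (D k)"
    using D V unfolding abelian_locally_normal_def by blast
  then show False using abelian_locally_normal_trivial k(1) by blast
qed

lemma normalizer_normalizes:
  assumes "H \<subseteq> carrier G"
  shows "normalizes (normalizer G H) H"
  unfolding normalizes_def
proof (intro ballI)
  fix g h assume g: "g \<in> normalizer G H" and h: "h \<in> H"
  have "conjugate g h \<in> g <# H #> inv g"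
    using h by (auto simp: conjugate_def l_coset_def r_coset_def)
  then show "conjugate g h \<in> H"
    using g assms by (simp add: normalizer_def stabilizer_def)
qed

text \<open>The closure of a subgroup \<open>K\<close> of finite index in \<open>H\<close> is open in the closure of \<open>H\<close>,
  so \<open>H \<inter> V\<close> is soluble for some open subgroup \<open>V\<close>.\<close>

theorem virtually_solvable_locally_normal_trivial:
  assumes H: "locally_normal H G T" and vs: "virtually_solvable (G\<lparr>carrier := H\<rparr>)"
  shows "H = {\<one>}"
proof -
  have sH: "subgroup H G" and N: "openin T (normalizer G H)"
    using H by (auto simp: locally_normal_def)
  have HG: "H \<subseteq> carrier G" using sH subgroup.subset by auto
  have sN: "subgroup (normalizer G H) G" using normalizer_imp_subgroup[OF HG] .
  obtain K where K: "subgroup K (G\<lparr>carrier := H\<rparr>)"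
    "finite (rcosets\<^bsub>G\<lparr>carrier := H\<rparr>\<^esub> K)" "solvable (G\<lparr>carrier := K\<rparr>)"
    using vs by (auto simp: virtually_solvable_def)
  have sK: "subgroup K G" using incl_subgroup[OF sH K(1)] .
  have KG: "K \<subseteq> carrier G" using sK subgroup.subset by auto
  have KH: "K \<subseteq> H" using subgroup.subset[OF K(1)] by simp
  have gK: "group (G\<lparr>carrier := K\<rparr>)" using subgroup_imp_group[OF sK] .
  interpret id: group_hom "G\<lparr>carrier := K\<rparr>" G "\<lambda>x. x"
    using gK KG is_group by (auto simp: group_hom_def group_hom_axioms_def hom_def)
  have "solvable_seq G K"
    using id.solvable_imp_solvable_img[of K] K(3) by (simp add: solvable_def)
  then obtain n where n: "(derived G ^^ n) K = {\<one>}"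
    using solvable_imp_trivial_derived_seq by blast
  have "(derived G ^^ n) (T closure_of K) \<subseteq> T closure_of {\<one>}"
    using exp_of_derived_closure_of[OF KG, of n] n by simp
  also have "T closure_of {\<one>} = {\<one>}"
    using closedin_Hausdorff_sing_eq[OF Hausdorff] topspace_eq closure_of_closedin
    by (metis one_closed)
  finally have n': "(derived G ^^ n) (T closure_of K) \<subseteq> {\<one>}" .
  let ?c = "T closure_of K"
  have sc: "subgroup ?c G" by (rule subgroup_closure_of[OF sK])
  have "rcosets\<^bsub>G\<lparr>carrier := H\<rparr>\<^esub> K = (\<lambda>h. K #> h) ` H"
    by (auto simp: RCOSETS_def r_coset_def)
  then obtain R where R: "R \<subseteq> H" "finite R" "(\<lambda>h. K #> h) ` H = (\<lambda>h. K #> h) ` R"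
    using finite_subset_image[of "(\<lambda>h. K #> h) ` H" "\<lambda>h. K #> h" H] K(2) by auto
  \<comment> \<open>\<open>O'\<close> is the complement of the closed cosets \<open>?c r\<close>
    over the finitely many representatives \<open>r\<close> outside \<open>?c\<close>. An element of
    \<open>H\<close> in \<open>O'\<close> thus has its representative in \<open>?c\<close>, and so
    lies in \<open>?c\<close> itself.\<close>
  define O' where "O' = (\<Inter>r\<in>R - ?c. {x \<in> carrier G. x \<otimes> inv r \<in> carrier G - ?c}) \<inter> topspace T"
  have "openin T O'"
    unfolding O'_def
  proof (rule openin_INT)
    fix r assume "r \<in> R - ?c"
    then have "r \<in> carrier G" using R(1) HG by blast
    then show "openin T {x \<in> carrier G. x \<otimes> inv r \<in> carrier G - ?c}"
      by (intro openin_preimage group_continuous_intros openin_diff) auto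
  qed (use R in simp)
  moreover have "\<one> \<in> O'"
  proof -
    have "inv r \<notin> ?c" if "r \<in> R - ?c" for r
      using that sc R(1) HG by (metis Diff_iff inv_inv subgroup.m_inv_closed subsetD)
    then show ?thesis using R(1) HG by (auto simp: O'_def topspace_eq)
  qed
  ultimately obtain V where V: "subgroup V G" "openin T V" "V \<subseteq> O' \<inter> normalizer G H"
    using compact_open_subgroup[of "O' \<inter> normalizer G H"] N subgroup.one_closed[OF sN] by blast
  have HV: "H \<inter> V \<subseteq> ?c"
  proof
    fix h assume h: "h \<in> H \<inter> V"
    have "h = \<one> \<otimes> h" using h HG by auto
    then have "h \<in> K #> h" using subgroup.one_closed[OF sK] unfolding r_coset_def by blast
    then obtain r where r: "r \<in> R" "h \<in> K #> r" using R(3) h by blast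
    then obtain x where x: "x \<in> K" "h = x \<otimes> r" by (auto simp: r_coset_def)
    have G: "r \<in> carrier G" "x \<in> carrier G" using r R(1) HG x KG by auto
    have xc: "x \<in> ?c" using closure_of_incl[OF KG] x by blast
    have "r \<in> ?c"
    proof (rule ccontr)
      assume "r \<notin> ?c"
      then have "h \<otimes> inv r \<notin> ?c" using h V(3) r by (auto simp: O'_def)
      moreover have "h \<otimes> inv r = x" using x(2) G by (simp add: m_assoc)
      ultimately show False using xc by simp
    qed
    then show "h \<in> ?c" using x xc sc by (simp add: subgroup.m_closed)
  qed
  \<comment> \<open>This makes \<open>H\<close> discrete; the final passage to \<open>H\<close>
    itself rests on the triviality of elements with open centraliser.\<close>
  have "H \<inter> V = {\<one>}"
  proof (rule solvable_locally_normal_trivial)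
    show "subgroup (H \<inter> V) G" using sH V(1) subgroups_Inter_pair by blast
    show "(derived G ^^ n) (H \<inter> V) \<subseteq> {\<one>}" using mono_exp_of_derived[OF HV, of n] n' by blast
    show "normalizes V (H \<inter> V)"
      using normalizes_mono[OF normalizer_normalizes[OF HG]] V subgroup_normalizes
      by (intro normalizes_Int) auto
  qed (use V in auto)
  moreover have "normalizes V H"
    using normalizes_mono[OF normalizer_normalizes[OF HG]] V(3) by blast
  ultimately show ?thesis
    using discrete_locally_normal_trivial[OF sH V(1,2) _ V(2)] subgroup.one_closed[OF V(1)] by blast
qed

text \<open>Part (ii) is an equality of sets of subgroups, so the identity subgroup must also be
  shown to qualify.\<close>

lemma trivial_locally_normal: "locally_normal {\<one>} G T"
proof -
  have "g <# {\<one>} #> inv g = {\<one>}" if "g \<in> carrier G" for g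
    using that by (auto simp: l_coset_def r_coset_def)
  then have "normalizer G {\<one>} = carrier G"
    by (auto simp: normalizer_def stabilizer_def)
  then show ?thesis by (simp add: locally_normal_def triv_subgroup)
qed

lemma trivial_virtually_solvable: "virtually_solvable (G\<lparr>carrier := {\<one>}\<rparr>)"
  unfolding virtually_solvable_def
proof (intro exI[of _ "{\<one>}"] conjI)
  interpret t: group "G\<lparr>carrier := {\<one>}\<rparr>"
    using subgroup_imp_group[OF triv_subgroup] .
  show "subgroup {\<one>} (G\<lparr>carrier := {\<one>}\<rparr>)" using t.triv_subgroup by simp
  show "finite (rcosets\<^bsub>G\<lparr>carrier := {\<one>}\<rparr>\<^esub> {\<one>})" by (simp add: RCOSETS_def)
  show "solvable (G\<lparr>carrier := {\<one>}, carrier := {\<one>}\<rparr>)"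
    using solvable_seq.unity[of "G\<lparr>carrier := {\<one>}\<rparr>"] by (simp add: solvable_def)
qed

end

theorem theorem1:
  fixes G :: "('a, 'b) monoid_scheme" and T :: "'a topology"
  assumes "topological_group G T"
    and "locally_compact_space T"
    and "totally_disconnected_space T"
    and "compactly_generated G T"
    and "top_char_simple G T"
    and "T \<noteq> discrete_topology (carrier G)"
    and "\<not> compact_space T"
  shows "\<not> (\<exists>x \<in> carrier G - {\<one>\<^bsub>G\<^esub>}. openin T (centralizer G x)) \<and>
    {H. locally_normal H G T \<and> virtually_solvable (G\<lparr>carrier := H\<rparr>)} = {{\<one>\<^bsub>G\<^esub>}}"
proof -
  interpret tdlc_group G T
    using assms by (simp add: tdlc_group_def tdlc_group_axioms_def)
  obtain U where "subgroup U G" "openin T U" "compactin T U"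
    using compact_open_subgroup[OF openin_carrier one_closed] .
  then interpret cg_char_simple_tdlc_group G T U
    using assms tdlc_group_axioms
    by (simp add: cg_char_simple_tdlc_group_def cg_char_simple_tdlc_group_axioms_def)
  show ?thesis
    using open_centralizer_trivial virtually_solvable_locally_normal_trivial
      trivial_locally_normal trivial_virtually_solvable by blast
qed

end
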